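(* Let $(X_t)_{t\in\mathbb Z}$ be a stationary $\mathbb R^p$-valued process, let $1\le k<n$, and let $\{f_\theta,\theta\in\Theta\}$ be a family of predictors, with $\theta\mapsto f_\theta$ linear. Let $\pi$ be a probability measure on $\Theta$ (the prior). Assume that the conditions Bound$(\mathcal B)$, LipLoss$(K)$, Lip$(L)$ and WeakDep$(\mathcal C)$ (see context) hold for some positive constants $\mathcal B,K,L,\mathcal C$, and set $\kappa=K(1+L)(\mathcal B+\mathcal C)/\sqrt2$. Then for all $\lambda>0$ and $\varepsilon>0$, the Gibbs estimator $\hat\theta_\lambda$ satisfies $$\mathbb P\left\{R(\hat\theta_\lambda)\le\inf_{\rho\in\mathcal M_+^1(\Theta)}\left[\int R\,\mathrm d\rho+\frac{2\lambda\kappa^2}{n(1-k/n)^2}+\frac{2\mathcal K(\rho,\pi)+2\log(2/\varepsilon)}{\lambda}\right]\right\}\ge1-\varepsilon .$$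
   Context: Setting. $\|\cdot\|$ is the Euclidean norm. $X_1,\dots,X_n$ are observed. For each $\theta$, $f_\theta:(\mathbb R^p)^k\to\mathbb R^p$, and $\hat X_t^\theta=f_\theta(X_{t-1},\dots,X_{t-k})$. The set $\Theta$ is a subset of a real vector space, $\theta\mapsto f_\theta$ is linear (so $f_\theta$ and the risk below also make sense at averages of elements of $\Theta$), and $\Theta$ carries a $\sigma$-algebra; measurability needed for the integrals to make sense is assumed. For a loss function $\ell$, the risk is $R(\theta)=\mathbb E[\ell(\hat X_t^\theta,X_t)]$ (independent of $t$ by stationarity) and the empirical risk is $r_n(\theta)=\frac1{n-k}\sum_{i=k+1}^n\ell(\hat X_i^\theta,X_i)$. $\mathcal M_+^1(\Theta)$ is the set of probability measures on $\Theta$. $\mathcal K(\rho,\pi)=\int\log\frac{\mathrm d\rho}{\mathrm d\pi}\,\mathrm d\rho$ if $\rho\ll\pi$ and $+\infty$ otherwise. Gibbs estimator: $\hat\theta_\lambda=\int_\Theta\theta\,\hat\rho_\lambda(\mathrm d\theta)$ with $\hat\rho_\lambda(\mathrm d\theta)=\dfrac{e^{-\lambda r_n(\theta)}\pi(\mathrm d\theta)}{\int e^{-\lambda r_n(\theta')}\pi(\mathrm d\theta')}$. Conditions. - Bound$(\mathcal B)$: $\|X_0\|\le\mathcal B$ almost surely. - LipLoss$(K)$: $\ell(x,x')=g(x-x')$ for some convex $K$-Lipschitz function $g\ge0$ with $g(0)=0$. - Lip$(L)$: for every $\theta\in\Theta$ there are coefficients $a_j(\theta)$, $1\le j\le k$,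 with $\sum_{j=1}^k a_j(\theta)\le L$ and $\|f_\theta(x_1,\dots,x_k)-f_\theta(y_1,\dots,y_k)\|\le\sum_{j=1}^k a_j(\theta)\|x_j-y_j\|$ for all $x_i,y_i\in\mathbb R^p$. - WeakDep$(\mathcal C)$: $\theta_{\infty,m}(1)\le\mathcal C$ for every integer $m>0$, where $$\theta_{\infty,m}(1)=\sup_{f\in\Lambda_1^m,\ 0<j_1<\dots<j_m}\Bigl\|\mathbb E[f(X_{j_1},\dots,X_{j_m})\mid X_t,t\le0]-\mathbb E[f(X_{j_1},\dots,X_{j_m})]\Bigr\|_\infty$$ and $\Lambda_1^m$ is the set of $f:(\mathbb R^p)^m\to\mathbb R$ with $|f(u_1,\dots,u_m)-f(u_1',\dots,u_m')|\le\sum_{j=1}^m\|u_j-u_j'\|$. *)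

theory Defs
  imports "HOL-Probability.Probability"
begin

text \<open>A tuple in \<open>(\<real>\<^sup>p)\<^sup>m\<close> is an extensional function on \<open>{1..m}\<close>; this is the underlying
  space of \<open>Pi\<^sub>M {1..m} (\<lambda>_. borel)\<close>.\<close>

abbreviation tuples :: "nat \<Rightarrow> (nat \<Rightarrow> real ^ 'p) set" where
  "tuples m \<equiv> {1..m} \<rightarrow>\<^sub>E UNIV"

definition stationary :: "'w measure \<Rightarrow> (int \<Rightarrow> 'w \<Rightarrow> real ^ 'p) \<Rightarrow> bool" where
  "stationary M X \<longleftrightarrow> (\<forall>t. X t \<in> borel_measurable M) \<and>
     (\<forall>h. distr M (Pi\<^sub>M UNIV (\<lambda>_. borel)) (\<lambda>\<omega> t. X (t + h) \<omega>) =
          distr M (Pi\<^sub>M UNIV (\<lambda>_. borel)) (\<lambda>\<omega> t. X t \<omega>))"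


section \<open>Predictors and risks\<close>

definition prediction ::
  "(int \<Rightarrow> 'w \<Rightarrow> real ^ 'p) \<Rightarrow> nat \<Rightarrow> ('b \<Rightarrow> (nat \<Rightarrow> real ^ 'p) \<Rightarrow> real ^ 'p) \<Rightarrow> 'b \<Rightarrow> int \<Rightarrow> 'w \<Rightarrow> real ^ 'p"
  where "prediction X k f \<theta> t \<omega> = f \<theta> (\<lambda>j\<in>{1..k}. X (t - int j) \<omega>)"

definition risk ::
  "'w measure \<Rightarrow> (int \<Rightarrow> 'w \<Rightarrow> real ^ 'p) \<Rightarrow> nat \<Rightarrow> ('b \<Rightarrow> (nat \<Rightarrow> real ^ 'p) \<Rightarrow> real ^ 'p) \<Rightarrow>
   (real ^ 'p \<Rightarrow> real ^ 'p \<Rightarrow> real) \<Rightarrow> int \<Rightarrow> 'b \<Rightarrow> real"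
  where "risk M X k f loss t \<theta> = (\<integral>\<omega>. loss (prediction X k f \<theta> t \<omega>) (X t \<omega>) \<partial>M)"

definition empirical_risk ::
  "(int \<Rightarrow> 'w \<Rightarrow> real ^ 'p) \<Rightarrow> nat \<Rightarrow> nat \<Rightarrow> ('b \<Rightarrow> (nat \<Rightarrow> real ^ 'p) \<Rightarrow> real ^ 'p) \<Rightarrow>
   (real ^ 'p \<Rightarrow> real ^ 'p \<Rightarrow> real) \<Rightarrow> 'b \<Rightarrow> 'w \<Rightarrow> real"
  where "empirical_risk X n k f loss \<theta> \<omega> =
    (\<Sum>i = k + 1..n. loss (prediction X k f \<theta> (int i) \<omega>) (X (int i) \<omega>)) / (real n - real k)"


section \<open>The Gibbs estimator\<close>

definition gibbs_posterior :: "'b measure \<Rightarrow> ('b \<Rightarrow> real) \<Rightarrow> real \<Rightarrow> 'b measure" where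
  "gibbs_posterior \<pi> r lam =
     density \<pi> (\<lambda>\<theta>. ennreal (exp (- lam * r \<theta>) / (\<integral>\<theta>'. exp (- lam * r \<theta>') \<partial>\<pi>)))"

text \<open>The integral \<open>\<integral>\<theta> \<mu>(d\<theta>)\<close> of a measure carried by a subset of a real vector space is
  taken in the weak (Gelfand--Pettis) sense. No compatibility between the topology and the vector
  space operations is needed. On a discrete space all linear functionals are tested, and on a
  Euclidean or Banach space the Bochner mean is recovered, see below.\<close>

definition is_mean :: "'b::{real_vector, topological_space} measure \<Rightarrow> 'b \<Rightarrow> bool" where
  "is_mean \<mu> m \<longleftrightarrow>
     (\<forall>\<phi> :: 'b \<Rightarrow> real. linear \<phi> \<and> continuous_on UNIV \<phi> \<longrightarrow>
        integrable \<mu> \<phi> \<and> \<phi> m = (\<integral>\<theta>. \<phi> \<theta> \<partial>\<mu>))"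

lemma is_mean_Bochner:
  fixes \<mu> :: "'b::{banach, second_countable_topology} measure"
  assumes int: "integrable \<mu> (\<lambda>\<theta>. \<theta>)"
  shows "is_mean \<mu> (\<integral>\<theta>. \<theta> \<partial>\<mu>)"
  unfolding is_mean_def
proof (intro allI impI, elim conjE)
  fix \<phi> :: "'b \<Rightarrow> real"
  assume lin: "linear \<phi>" and "continuous_on UNIV \<phi>"
  then have "isCont \<phi> 0"
    by (simp add: continuous_on_eq_continuous_at)
  then obtain d where d: "d > 0" "\<And>x. norm x < d \<Longrightarrow> \<bar>\<phi> x\<bar> < 1"
    using linear_0[OF lin] unfolding continuous_at_eps_delta
    by (auto simp: dist_norm dest!: spec[of _ 1])
  have "norm (\<phi> x) \<le> norm x * (2 / d)" for x
  proof (cases "x = 0")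
    case False
    define c where "c = d / (2 * norm x)"
    have c: "c > 0" using d False by (simp add: c_def)
    have "norm (c *\<^sub>R x) < d" using d False by (simp add: c_def)
    then have "\<bar>\<phi> (c *\<^sub>R x)\<bar> < 1" by (rule d(2))
    then have "c * \<bar>\<phi> x\<bar> < 1"
      using c by (simp add: linear_scale[OF lin] abs_mult)
    then show ?thesis
      using d False by (simp add: c_def field_simps)
  qed (simp add: linear_0[OF lin])
  then have bl: "bounded_linear \<phi>"
    by (intro bounded_linear_intro[where K = "2 / d"])
      (simp_all add: linear_add[OF lin] linear_scale[OF lin])
  show "integrable \<mu> \<phi> \<and> \<phi> (\<integral>\<theta>. \<theta> \<partial>\<mu>) = (\<integral>\<theta>. \<phi> \<theta> \<partial>\<mu>)"
    using integrable_bounded_linear[OF bl int] integral_bounded_linear[OF bl int] by simp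
qed

lemma is_mean_euclidean:
  fixes \<mu> :: "'b::euclidean_space measure"
  shows "is_mean \<mu> m \<longleftrightarrow> integrable \<mu> (\<lambda>\<theta>. \<theta>) \<and> m = (\<integral>\<theta>. \<theta> \<partial>\<mu>)"
proof
  assume mean: "is_mean \<mu> m"
  have coord: "integrable \<mu> (\<lambda>\<theta>. \<theta> \<bullet> b) \<and> m \<bullet> b = (\<integral>\<theta>. \<theta> \<bullet> b \<partial>\<mu>)" for b
    using mean unfolding is_mean_def
    by (auto intro!: continuous_intros bounded_linear.linear bounded_linear_inner_left)
  have "integrable \<mu> (\<lambda>\<theta>. \<Sum>b\<in>Basis. (\<theta> \<bullet> b) *\<^sub>R b)"
    using coord by (intro Bochner_Integration.integrable_sum integrable_scaleR_left) auto
  then have int: "integrable \<mu> (\<lambda>\<theta>. \<theta>)"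
    by (simp add: euclidean_representation)
  moreover have "m = (\<integral>\<theta>. \<theta> \<partial>\<mu>)"
    by (rule euclidean_eqI) (use coord int in simp)
  ultimately show "integrable \<mu> (\<lambda>\<theta>. \<theta>) \<and> m = (\<integral>\<theta>. \<theta> \<partial>\<mu>)" ..
qed (use is_mean_Bochner in auto)


section \<open>Kullback--Leibler divergence\<close>

text \<open>The first argument of \<^const>\<open>KL_divergence\<close> is the base of the logarithm and the second one
  the reference measure. If \<open>\<rho>\<close> is absolutely continuous, the negative part of the log-density is
  always \<open>\<rho>\<close>-integrable, so that non-integrability means that the integral is \<open>+\<infinity>\<close>.\<close>

definition kl :: "'b measure \<Rightarrow> 'b measure \<Rightarrow> ereal" where
  "kl \<rho> \<pi> =
     (if absolutely_continuous \<pi> \<rho> \<and> integrable \<rho> (entropy_density (exp 1) \<pi> \<rho>)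
      then ereal (KL_divergence (exp 1) \<pi> \<rho>) else \<infinity>)"


section \<open>Conditions\<close>

definition LipLoss :: "real \<Rightarrow> (real ^ 'p \<Rightarrow> real ^ 'p \<Rightarrow> real) \<Rightarrow> bool" where
  "LipLoss K loss \<longleftrightarrow>
     (\<exists>g. (\<forall>x x'. loss x x' = g (x - x')) \<and> convex_on UNIV g \<and> K-lipschitz_on UNIV g \<and>
          (\<forall>x. 0 \<le> g x) \<and> g 0 = 0)"

definition Lip ::
  "real \<Rightarrow> nat \<Rightarrow> 'b set \<Rightarrow> ('b \<Rightarrow> (nat \<Rightarrow> real ^ 'p) \<Rightarrow> real ^ 'p) \<Rightarrow> bool"
  where "Lip L k \<Theta> f \<longleftrightarrow>
     (\<forall>\<theta>\<in>\<Theta>. \<exists>a :: nat \<Rightarrow> real. (\<Sum>j = 1..k. a j) \<le> L \<and>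
        (\<forall>x\<in>tuples k. \<forall>y\<in>tuples k. norm (f \<theta> x - f \<theta> y) \<le> (\<Sum>j = 1..k. a j * norm (x j - y j))))"

definition Lambda1 :: "nat \<Rightarrow> ((nat \<Rightarrow> real ^ 'p) \<Rightarrow> real) set" where
  "Lambda1 m =
     {h. \<forall>u\<in>tuples m. \<forall>u'\<in>tuples m. \<bar>h u - h u'\<bar> \<le> (\<Sum>j = 1..m. norm (u j - u' j))}"

definition past :: "'w measure \<Rightarrow> (int \<Rightarrow> 'w \<Rightarrow> real ^ 'p) \<Rightarrow> 'w measure" where
  "past M X = sigma (space M) {X t -` A \<inter> space M | t A. t \<le> 0 \<and> A \<in> sets borel}"

definition theta_inf :: "'w measure \<Rightarrow> (int \<Rightarrow> 'w \<Rightarrow> real ^ 'p) \<Rightarrow> nat \<Rightarrow> ereal" where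
  "theta_inf M X m =
     (SUP (h, j) \<in> Lambda1 m \<times> {j :: nat \<Rightarrow> int. strict_mono_on {1..m} j \<and> (\<forall>i\<in>{1..m}. 0 < j i)}.
        esssup M (\<lambda>\<omega>. ereal
          \<bar>real_cond_exp M (past M X) (\<lambda>\<omega>'. h (\<lambda>i\<in>{1..m}. X (j i) \<omega>')) \<omega>
            - (\<integral>\<omega>'. h (\<lambda>i\<in>{1..m}. X (j i) \<omega>') \<partial>M)\<bar>))"

definition WeakDep :: "real \<Rightarrow> 'w measure \<Rightarrow> (int \<Rightarrow> 'w \<Rightarrow> real ^ 'p) \<Rightarrow> bool" where
  "WeakDep C M X \<longleftrightarrow> (\<forall>m>0. theta_inf M X m \<le> ereal C)"

end

theory Submission
  imports Defs
begin

text \<open>For a Lipschitz function \<open>h\<close> of \<open>X\<^sub>1, \<dots>, X\<^sub>n\<close>, consider the martingale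
  \<open>E[h | X\<^sub>1, \<dots>, X\<^sub>i]\<close>. Weak dependence replaces the conditional law of the future by its
  unconditional law at the price \<open>C\<close>, and boundedness replaces \<open>X\<^sub>i\<close> by \<open>0\<close> at the price \<open>B\<close>. So, given
  \<open>X\<^sub>1, \<dots>, X\<^sub>i\<^sub>-\<^sub>1\<close>, the martingale at time \<open>i\<close> ranges in an interval of half-width \<open>B + C\<close>, and the
  conditional form of Hoeffding's lemma yields sub-Gaussian exponential moments of \<open>h\<close> (Rio's
  inequality). For the empirical risk \<open>r\<close>, this bounds the expectations of
  \<open>\<integral> exp (\<plusminus>\<lambda>(R - r) - \<lambda>V) d\<pi>\<close> by \<open>1\<close>, where \<open>V = \<lambda>\<kappa>\<^sup>2 / (n (1 - k / n)\<^sup>2)\<close>. By Markov's inequality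
  both integrals are at most \<open>2 / \<epsilon>\<close> with probability at least \<open>1 - \<epsilon>\<close>. With
  \<open>Z = \<integral> exp (- \<lambda>r) d\<pi>\<close>, the first one gives \<open>\<lambda> \<integral> R d\<rho>' \<le> \<lambda>V + ln (2 / \<epsilon>) - ln Z\<close> for the Gibbs
  posterior \<open>\<rho>'\<close>, and the second one bounds \<open>- ln Z\<close> by the Donsker--Varadhan inequality. Finally, the
  risk of the posterior mean is at most the posterior mean of the risk, by Jensen's inequality.\<close>

section \<open>Hoeffding and Jensen inequalities\<close>

text \<open>Convexity: \<open>a * u\<close> is the mixture of \<open>-a\<close> and \<open>a\<close>
  with weights \<open>(1 - u) / 2\<close> and \<open>(1 + u) / 2\<close>, and the right-hand side is
  the chord of the exponential between these two points.\<close>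

lemma exp_le_cosh_sinh:
  fixes a u :: real
  assumes "\<bar>u\<bar> \<le> 1"
  shows "exp (a * u) \<le> cosh a + u * sinh a"
proof -
  have "convex_on UNIV (exp :: real \<Rightarrow> real)"
    using convex_on_exp[of 1] by simp
  from convex_onD[OF this, of "(1 + u) / 2" "-a" a] assms
  have "exp ((1 - (1 + u) / 2) *\<^sub>R (-a) + ((1 + u) / 2) *\<^sub>R a)
    \<le> (1 - (1 + u) / 2) * exp (-a) + ((1 + u) / 2) * exp a"
    by (simp add: abs_le_iff)
  moreover have "(1 - (1 + u) / 2) *\<^sub>R (-a) + ((1 + u) / 2) *\<^sub>R a = a * u"
    by (simp add: field_simps)
  ultimately show ?thesis
    by (simp add: cosh_def sinh_def field_simps)
qed

text \<open>The left-hand side is the moment generating function at \<open>a\<close> of a random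
  sign with mean \<open>u\<close>, so this is Hoeffding's lemma for a two-point law.\<close>

lemma cosh_sinh_le_exp:
  fixes a u :: real
  assumes "\<bar>u\<bar> \<le> 1"
  shows "cosh a + u * sinh a \<le> exp (a * u + a\<^sup>2 / 2)"
proof -
  have *: "cosh a + u * sinh a \<le> exp (a * u + a\<^sup>2 / 2)" if "\<bar>u\<bar> \<le> 1" "0 \<le> a" for a u :: real
  proof -
    define p where "p = (1 + u) / 2"
    have p: "0 \<le> p" "u = 2 * p - 1" using that by (simp_all add: p_def field_simps)
    have pos: "0 < 1 + p * (exp (2 * a) - 1)"
      using p that by (intro add_pos_nonneg mult_nonneg_nonneg) auto
    \<comment> \<open>The values -1 and 1 are 2 apart, hence the argument
      \<open>2 * a\<close>.\<close>
    have "- (2 * a) * p + ln (1 + p * (exp (2 * a) - 1)) \<le> (2 * a)\<^sup>2 / 8"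
      by (rule Hoeffdings_lemma_aux) (use p that in auto)
    then have "ln (1 + p * (exp (2 * a) - 1)) \<le> a * u + a\<^sup>2 / 2 + a"
      by (simp add: p power2_eq_square algebra_simps)
    then have "1 + p * (exp (2 * a) - 1) \<le> exp (a * u + a\<^sup>2 / 2 + a)"
      using pos by (metis exp_le_cancel_iff exp_ln)
    then have "exp (-a) * (1 + p * (exp (2 * a) - 1)) \<le> exp (-a) * exp (a * u + a\<^sup>2 / 2 + a)"
      by (intro mult_left_mono) auto
    moreover have "exp (-a) * exp (a * u + a\<^sup>2 / 2 + a) = exp (a * u + a\<^sup>2 / 2)"
      by (simp flip: exp_add)
    moreover have "exp (-a) * (1 + p * (exp (2 * a) - 1)) = cosh a + u * sinh a"
    proof -
      have "exp (-a) * exp (2 * a) = exp a" by (simp flip: exp_add)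
      then show ?thesis by (simp add: p cosh_def sinh_def field_simps)
    qed
    ultimately show ?thesis by simp
  qed
  \<comment> \<open>Negating both \<open>a\<close> and \<open>u\<close> changes neither side, which
    covers \<open>a < 0\<close>.\<close>
  show ?thesis
    using *[of u a] *[of "-u" "-a"] assms by (cases "0 \<le> a") auto
qed

text \<open>On \<open>[c - w, c + w]\<close> the chord of \<open>exp (s * v)\<close> is affine in
  \<open>v\<close> with \<open>F\<close>-measurable coefficients, so under the integral
  \<open>V\<close> may be replaced by its conditional expectation. The two-point bound then leads
  back to an exponential, and the centre \<open>c\<close> cancels from the exponent.\<close>

lemma (in prob_space) conditional_Hoeffding:
  fixes V c :: "'a \<Rightarrow> real"
  assumes F: "subalgebra M F"
    and V [measurable]: "V \<in> borel_measurable M" and bounded: "AE x in M. \<bar>V x\<bar> \<le> b"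
    and c: "c \<in> borel_measurable F" and w: "0 < w"
    and near: "AE x in M. \<bar>V x - c x\<bar> \<le> w"
  shows "(\<integral>x. exp (s * V x) \<partial>M) \<le>
    exp (s\<^sup>2 * w\<^sup>2 / 2) * (\<integral>x. exp (s * real_cond_exp M F V x) \<partial>M)"
proof -
  interpret finite_measure_subalgebra M F
    by unfold_locales (rule F)
  define m where "m = real_cond_exp M F V"
  \<comment> \<open>Slope \<open>S\<close> and intercept \<open>T\<close> of the chord; both depend
    on \<open>x\<close> only through \<open>c x\<close>.\<close>
  define S where "S = (\<lambda>x. exp (s * c x) * (sinh (s * w) / w))"
  define T where "T = (\<lambda>x. exp (s * c x) * cosh (s * w) - S x * c x)"
  have cM [measurable]: "c \<in> borel_measurable M"
    by (rule measurable_from_subalg[OF F c])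
  have SF: "S \<in> borel_measurable F" using c by (simp add: S_def)
  have SM [measurable]: "S \<in> borel_measurable M" by (rule measurable_from_subalg[OF F SF])
  have TM [measurable]: "T \<in> borel_measurable M" unfolding T_def by simp
  have mM [measurable]: "m \<in> borel_measurable M" unfolding m_def by simp
  have intV: "integrable M V"
    by (rule integrable_const_bound[where B = b]) (use bounded in auto)
  have "AE x in M. m x \<le> b" "AE x in M. -b \<le> m x"
    unfolding m_def by (intro real_cond_exp_le_c real_cond_exp_ge_c intV;
      use bounded in eventually_elim; simp)+
  then have mb: "AE x in M. \<bar>m x\<bar> \<le> b" by eventually_elim simp
  have cb: "AE x in M. \<bar>c x\<bar> \<le> b + w"
    using near bounded by eventually_elim simp
  have ecb: "AE x in M. exp (s * c x) \<le> exp (\<bar>s\<bar> * (b + w))"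
    using cb
  proof eventually_elim
    case (elim x)
    have "s * c x \<le> \<bar>s\<bar> * \<bar>c x\<bar>" by (simp flip: abs_mult)
    also have "\<dots> \<le> \<bar>s\<bar> * (b + w)" using elim by (intro mult_left_mono) auto
    finally show ?case by simp
  qed
  have intexp: "integrable M (\<lambda>x. exp (s * U x))"
    if "AE x in M. \<bar>U x\<bar> \<le> b" and [measurable]: "U \<in> borel_measurable M" for U :: "'a \<Rightarrow> real"
  proof (rule integrable_const_bound[where B = "exp (\<bar>s\<bar> * b)"])
    show "AE x in M. norm (exp (s * U x)) \<le> exp (\<bar>s\<bar> * b)"
      using that(1)
    proof eventually_elim
      case (elim x)
      have "s * U x \<le> \<bar>s\<bar> * \<bar>U x\<bar>" by (simp flip: abs_mult)
      also have "\<dots> \<le> \<bar>s\<bar> * b" using elim by (intro mult_left_mono) auto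
      finally show ?case by simp
    qed
  qed simp
  have intSU: "integrable M (\<lambda>x. S x * U x)"
    if "AE x in M. \<bar>U x\<bar> \<le> d" and [measurable]: "U \<in> borel_measurable M" for U d
  proof (rule integrable_const_bound[where B = "exp (\<bar>s\<bar> * (b + w)) * \<bar>sinh (s * w) / w\<bar> * d"])
    show "AE x in M. norm (S x * U x) \<le> exp (\<bar>s\<bar> * (b + w)) * \<bar>sinh (s * w) / w\<bar> * d"
      using that(1) ecb
    proof eventually_elim
      case (elim x)
      have "norm (S x * U x) = exp (s * c x) * \<bar>sinh (s * w) / w\<bar> * \<bar>U x\<bar>"
        by (simp only: S_def real_norm_def abs_mult abs_exp_cancel)
      also have "\<dots> \<le> exp (\<bar>s\<bar> * (b + w)) * \<bar>sinh (s * w) / w\<bar> * d"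
        using elim by (intro mult_mono) auto
      finally show ?case .
    qed
  qed simp
  have intec: "integrable M (\<lambda>x. exp (s * c x) * cosh (s * w))"
    by (intro integrable_mult_left integrable_const_bound[where B = "exp (\<bar>s\<bar> * (b + w))"])
      (use ecb in auto)
  have intT: "integrable M T"
    unfolding T_def by (intro Bochner_Integration.integrable_diff intSU[OF cb] intec) simp
  have iSV: "integrable M (\<lambda>x. S x * V x)" by (rule intSU[OF bounded]) simp
  have iSm: "integrable M (\<lambda>x. S x * m x)" by (rule intSU[OF mb]) simp
  have eq: "exp (s * c x) * (cosh (s * w) + ((v - c x) / w) * sinh (s * w)) = T x + S x * v" for x v
    using w by (simp add: T_def S_def field_simps)
  \<comment> \<open>The two-point bound requires \<open>(m x - c x) / w\<close> to lie in
    \<open>[-1, 1]\<close>. This follows by conditioning the bounds on \<open>V - c\<close>, as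
    \<open>c\<close> is its own conditional expectation.\<close>
  have mnear: "AE x in M. \<bar>m x - c x\<bar> \<le> w"
  proof -
    have 1: "integrable M c"
      by (rule integrable_const_bound[where B = "b + w"]) (use cb in auto)
    have "AE x in M. real_cond_exp M F (\<lambda>x. V x - c x) x = m x - real_cond_exp M F c x"
      unfolding m_def by (rule real_cond_exp_diff) (use intV 1 in auto)
    moreover have "AE x in M. real_cond_exp M F c x = c x"
      by (rule real_cond_exp_F_meas[OF 1 c])
    moreover have "AE x in M. real_cond_exp M F (\<lambda>x. V x - c x) x \<le> w"
        "AE x in M. -w \<le> real_cond_exp M F (\<lambda>x. V x - c x) x"
      by (intro real_cond_exp_le_c real_cond_exp_ge_c Bochner_Integration.integrable_diff intV 1;
        use near in eventually_elim; simp)+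
    ultimately show ?thesis by eventually_elim simp
  qed
  have "(\<integral>x. exp (s * V x) \<partial>M) \<le> (\<integral>x. T x + S x * V x \<partial>M)"
  proof (rule integral_mono_AE)
    show "AE x in M. exp (s * V x) \<le> T x + S x * V x"
      using near
    proof eventually_elim
      case (elim x)
      have "exp (s * V x) = exp (s * c x) * exp ((s * w) * ((V x - c x) / w))"
        using w by (simp add: field_simps flip: exp_add)
      also have "\<dots> \<le> exp (s * c x) * (cosh (s * w) + ((V x - c x) / w) * sinh (s * w))"
        using elim w by (intro mult_left_mono exp_le_cosh_sinh) auto
      finally show ?case by (simp only: eq)
    qed
  qed (use intexp[OF bounded] intT iSV in auto)
  also have "\<dots> = (\<integral>x. T x \<partial>M) + (\<integral>x. S x * V x \<partial>M)"
    using intT iSV by simp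
  also have "(\<integral>x. S x * V x \<partial>M) = (\<integral>x. S x * m x \<partial>M)"
    unfolding m_def by (rule real_cond_exp_intg(2)[symmetric]) (use iSV SF in auto)
  also have "(\<integral>x. T x \<partial>M) + (\<integral>x. S x * m x \<partial>M) = (\<integral>x. T x + S x * m x \<partial>M)"
    using intT iSm by simp
  also have "\<dots> \<le> (\<integral>x. exp (s\<^sup>2 * w\<^sup>2 / 2) * exp (s * m x) \<partial>M)"
  proof (rule integral_mono_AE)
    show "AE x in M. T x + S x * m x \<le> exp (s\<^sup>2 * w\<^sup>2 / 2) * exp (s * m x)"
      using mnear
    proof eventually_elim
      case (elim x)
      have "T x + S x * m x
        = exp (s * c x) * (cosh (s * w) + ((m x - c x) / w) * sinh (s * w))"
        by (simp only: eq)
      also have "\<dots> \<le> exp (s * c x) * exp ((s * w) * ((m x - c x) / w) + (s * w)\<^sup>2 / 2)"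
        using elim w by (intro mult_left_mono cosh_sinh_le_exp) auto
      also have "\<dots> = exp (s * c x + (s * m x - s * c x + s\<^sup>2 * w\<^sup>2 / 2))"
        using w by (simp add: power_mult_distrib field_simps flip: exp_add)
      also have "\<dots> = exp (s\<^sup>2 * w\<^sup>2 / 2) * exp (s * m x)"
        by (simp flip: exp_add add: add.commute)
      finally show ?case .
    qed
  qed (use intexp[OF mb] intT iSm in auto)
  finally show ?thesis by (simp add: m_def)
qed

text \<open>If the inequality failed, the pair of means would lie below the graph of
  \<open>g\<close>, and a hyperplane would separate it from the closed convex epigraph. Integrating
  the separating inequality over the graph points \<open>(Y x, g (Y x))\<close> contradicts
  this.\<close>

lemma (in prob_space) Jensen_euclidean:
  fixes Y :: "'a \<Rightarrow> 'c::euclidean_space" and g :: "'c \<Rightarrow> real"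
  assumes Y: "integrable M Y" and gY: "integrable M (\<lambda>x. g (Y x))"
    and g: "convex_on UNIV g" and cont: "continuous_on UNIV g"
  shows "g (\<integral>x. Y x \<partial>M) \<le> (\<integral>x. g (Y x) \<partial>M)"
proof (rule ccontr)
  let ?S = "epigraph UNIV g" and ?z = "(\<integral>x. Y x \<partial>M, \<integral>x. g (Y x) \<partial>M)"
  assume "\<not> ?thesis"
  then have "?z \<notin> ?S" by (simp add: epigraph_def)
  moreover have "convex ?S" using g by (simp add: convex_epigraph)
  moreover have "closed {xy. g (fst xy) \<le> snd xy}"
    by (intro closed_Collect_le continuous_on_compose2[OF cont] continuous_intros) auto
  then have "closed ?S" by (simp add: epigraph_def)
  ultimately obtain a b where ab: "a \<bullet> ?z < b" "\<And>x. x \<in> ?S \<Longrightarrow> a \<bullet> x > b"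
    using separating_hyperplane_closed_point[of ?S ?z] by blast
  obtain a1 a2 where a: "a = (a1, a2)" by (cases a)
  have "b = (\<integral>x. b \<partial>M)" by (simp add: prob_space)
  also have "\<dots> \<le> (\<integral>x. a1 \<bullet> Y x + a2 * g (Y x) \<partial>M)"
  proof (rule integral_mono)
    fix x
    show "b \<le> a1 \<bullet> Y x + a2 * g (Y x)"
      using ab(2)[of "(Y x, g (Y x))"] by (simp add: epigraph_def a)
  qed (use Y gY in auto)
  also have "\<dots> = a \<bullet> ?z"
    using Y gY by (simp add: a)
  finally show False using ab(1) by simp
qed

section \<open>Weakly dependent processes\<close>

lemma Lambda1_D:
  "h \<in> Lambda1 m \<Longrightarrow> u \<in> tuples m \<Longrightarrow> u' \<in> tuples m \<Longrightarrow>
    \<bar>h u - h u'\<bar> \<le> (\<Sum>j = 1..m. norm (u j - u' j))"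
  by (auto simp: Lambda1_def)

lemma Lambda1_uminus: "h \<in> Lambda1 m \<Longrightarrow> (\<lambda>u. - h u) \<in> Lambda1 m"
  by (force simp: Lambda1_def)

text \<open>Extended to all sequences by restriction, \<open>h\<close> is continuous for the product
  topology, because its Lipschitz bound involves finitely many coordinates. On sequences the Borel
  sets of this topology form the product sigma-algebra, into which the tuples are then
  included.\<close>

lemma Lambda1_measurable:
  fixes h :: "(nat \<Rightarrow> real ^ 'p) \<Rightarrow> real"
  assumes h: "h \<in> Lambda1 m"
  shows "h \<in> borel_measurable (Pi\<^sub>M {1..m} (\<lambda>_. borel))"
proof -
  define h' where "h' = (\<lambda>u. h (restrict u {1..m}))"
  have "continuous_on UNIV h'"
    unfolding continuous_on_eq_continuous_at[OF open_UNIV]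
  proof
    fix u :: "nat \<Rightarrow> real ^ 'p"
    have "continuous_on UNIV (\<lambda>v :: nat \<Rightarrow> real ^ 'p. v j)" for j
      by (rule continuous_on_product_coordinates)
    then have "isCont (\<lambda>v. v j) u" for j
      using continuous_on_eq_continuous_at[OF open_UNIV] by blast
    then have lim: "((\<lambda>v. \<Sum>j = 1..m. norm (v j - u j)) \<longlongrightarrow> (\<Sum>j = 1..m. norm (u j - u j))) (at u)"
      unfolding isCont_def by (intro tendsto_sum tendsto_norm tendsto_diff tendsto_const)
    have le: "\<bar>h' v - h' u\<bar> \<le> (\<Sum>j = 1..m. norm (v j - u j))" for v
      using Lambda1_D[OF h, of "restrict v {1..m}" "restrict u {1..m}"]
      by (simp add: h'_def)
    have "((\<lambda>v. h' v - h' u) \<longlongrightarrow> 0) (at u)"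
      by (rule Lim_null_comparison[of _ "\<lambda>v. \<Sum>j = 1..m. norm (v j - u j)"]) (use le lim in simp_all)
    then show "isCont h' u"
      unfolding isCont_def by (rule LIM_zero_cancel)
  qed
  then have "h' \<in> borel_measurable (Pi\<^sub>M UNIV (\<lambda>_. borel))"
    unfolding measurable_cong_sets[OF sets_PiM_equal_borel refl]
    by (rule borel_measurable_continuous_onI)
  moreover have "(\<lambda>u. u) \<in> measurable (Pi\<^sub>M {1..m} (\<lambda>_. borel :: (real ^ 'p) measure)) (Pi\<^sub>M UNIV (\<lambda>_. borel))"
  proof (rule measurable_PiM_single')
    fix i :: nat
    show "(\<lambda>u. u i) \<in> borel_measurable (Pi\<^sub>M {1..m} (\<lambda>_. borel :: (real ^ 'p) measure))"
    proof (cases "i \<in> {1..m}")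
      \<comment> \<open>On extensional functions a coordinate outside the index set is the constant
        \<open>undefined\<close>.\<close>
      case False
      then have "(\<lambda>u. u i) \<in> borel_measurable (Pi\<^sub>M {1..m} (\<lambda>_. borel :: (real ^ 'p) measure)) \<longleftrightarrow>
        (\<lambda>u. undefined :: real ^ 'p) \<in> borel_measurable (Pi\<^sub>M {1..m} (\<lambda>_. borel :: (real ^ 'p) measure))"
        by (intro measurable_cong) (auto simp: space_PiM PiE_def extensional_def)
      then show ?thesis by simp
    qed simp
  qed (auto simp: space_PiM)
  ultimately have "(\<lambda>u. h' u) \<in> borel_measurable (Pi\<^sub>M {1..m} (\<lambda>_. borel))"
    by (rule measurable_compose[rotated])
  moreover have "h' u = h u" if "u \<in> space (Pi\<^sub>M {1..m} (\<lambda>_. borel))" for u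
    using that by (simp add: h'_def space_PiM PiE_restrict)
  ultimately show ?thesis
    by (subst measurable_cong[where g = h', OF sym]) auto
qed

section \<open>Stationarity and boundedness at all times\<close>

locale bounded_weakly_dependent = prob_space M for M :: "'w measure" +
  fixes X :: "int \<Rightarrow> 'w \<Rightarrow> real ^ 'p" and B C :: real
  assumes stat: "stationary M X" and B: "0 < B" and C: "0 < C"
    and bounded_0: "AE \<omega> in M. norm (X 0 \<omega>) \<le> B"
    and weak_dep: "WeakDep C M X"
begin

text \<open>Time \<open>a\<close> itself is excluded: \<open>block 0 i\<close> and
  \<open>block (int i) m\<close> are adjacent windows, and \<open>block (- int i) i\<close> ends at
  time 0, inside the past.\<close>

definition block :: "int \<Rightarrow> nat \<Rightarrow> 'w \<Rightarrow> nat \<Rightarrow> real ^ 'p" where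
  "block a m \<omega> = (\<lambda>l\<in>{1..m}. X (a + int l) \<omega>)"

lemma X_measurable [measurable]: "X t \<in> borel_measurable M"
  using stat by (auto simp: stationary_def)

lemma block_in_tuples: "block a m \<omega> \<in> tuples m"
  by (auto simp: block_def)

lemma block_measurable [measurable]:
  "block a m \<in> measurable M (Pi\<^sub>M {1..m} (\<lambda>_. borel))"
  unfolding block_def by (intro measurable_restrict) simp

text \<open>Functionals of the whole path are taken because a past window and a future window have
  to be shifted jointly.\<close>

lemma integral_shift:
  fixes \<Psi> :: "(int \<Rightarrow> real ^ 'p) \<Rightarrow> real"
  assumes [measurable]: "\<Psi> \<in> borel_measurable (Pi\<^sub>M UNIV (\<lambda>_. borel))"
  shows "(\<integral>\<omega>. \<Psi> (\<lambda>t. X (t + a) \<omega>) \<partial>M) = (\<integral>\<omega>. \<Psi> (\<lambda>t. X t \<omega>) \<partial>M)"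
proof -
  have [measurable]: "(\<lambda>\<omega> t. X (t + a) \<omega>) \<in> measurable M (Pi\<^sub>M UNIV (\<lambda>_. borel))" for a
    by (rule measurable_PiM_single') auto
  have "(\<integral>\<omega>. \<Psi> (\<lambda>t. X (t + a) \<omega>) \<partial>M)
      = (\<integral>x. \<Psi> x \<partial>distr M (Pi\<^sub>M UNIV (\<lambda>_. borel)) (\<lambda>\<omega> t. X (t + a) \<omega>))"
    by (rule integral_distr[symmetric]) measurable
  also have "\<dots> = (\<integral>x. \<Psi> x \<partial>distr M (Pi\<^sub>M UNIV (\<lambda>_. borel)) (\<lambda>\<omega> t. X (t + 0) \<omega>))"
    using stat by (simp add: stationary_def)
  also have "\<dots> = (\<integral>\<omega>. \<Psi> (\<lambda>t. X (t + 0) \<omega>) \<partial>M)"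
    by (rule integral_distr) measurable
  finally show ?thesis by simp
qed

lemma bounded: "AE \<omega> in M. norm (X t \<omega>) \<le> B"
proof -
  have "prob {\<omega> \<in> space M. norm (X t \<omega>) \<le> B} = (\<integral>\<omega>. indicat_real (cball 0 B) (X (0 + t) \<omega>) \<partial>M)"
  proof -
    have "(\<integral>\<omega>. indicat_real (cball 0 B) (X (0 + t) \<omega>) \<partial>M)
        = (\<integral>\<omega>. indicat_real {\<omega> \<in> space M. norm (X t \<omega>) \<le> B} \<omega> \<partial>M)"
      by (intro Bochner_Integration.integral_cong) (auto simp: indicator_def)
    then show ?thesis by simp
  qed
  also have "\<dots> = (\<integral>\<omega>. indicat_real (cball 0 B) (X 0 \<omega>) \<partial>M)"
    by (rule integral_shift[of "\<lambda>x. indicat_real (cball 0 B) (x 0)"])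
      (rule measurable_compose[OF measurable_component_singleton borel_measurable_indicator]; simp)
  also have "\<dots> = (\<integral>\<omega>. 1 \<partial>M)"
    by (rule integral_cong_AE) (use bounded_0 in \<open>auto simp: indicator_def\<close>)
  finally have "prob {\<omega> \<in> space M. norm (X t \<omega>) \<le> B} = 1" by (simp add: prob_space)
  then show ?thesis by (subst (asm) prob_Collect_eq_1) auto
qed

lemma bounded_all: "AE \<omega> in M. \<forall>t. norm (X t \<omega>) \<le> B"
  using bounded by (simp add: AE_all_countable)

lemma AE_Lambda1_bounded:
  assumes "h \<in> Lambda1 m"
  shows "AE \<omega> in M. \<bar>h (block a m \<omega>)\<bar> \<le> \<bar>h (\<lambda>l\<in>{1..m}. 0)\<bar> + real m * B"
  using bounded_all
proof eventually_elim
  case (elim \<omega>)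
  have "\<bar>h (block a m \<omega>) - h (\<lambda>l\<in>{1..m}. 0)\<bar> \<le>
      (\<Sum>j = 1..m. norm (block a m \<omega> j - (\<lambda>l\<in>{1..m}. 0) j))"
    by (rule Lambda1_D[OF assms]) (rule block_in_tuples, simp)
  also have "\<dots> \<le> (\<Sum>j = 1..m. B)"
    using elim by (intro sum_mono) (auto simp: block_def)
  finally show ?case by simp
qed

lemma Lambda1_block_measurable [measurable]:
  "h \<in> Lambda1 m \<Longrightarrow> (\<lambda>\<omega>. h (block a m \<omega>)) \<in> borel_measurable M"
  by (rule measurable_compose[OF block_measurable Lambda1_measurable])

lemma Lambda1_block_integrable:
  "h \<in> Lambda1 m \<Longrightarrow> integrable M (\<lambda>\<omega>. h (block a m \<omega>))"
  by (rule integrable_const_bound[OF AE_Lambda1_bounded[unfolded real_norm_def[symmetric]]]) auto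

lemma expectation_block_shift:
  assumes "h \<in> Lambda1 m"
  shows "(\<integral>\<omega>. h (block a m \<omega>) \<partial>M) = (\<integral>\<omega>. h (block 0 m \<omega>) \<partial>M)"
proof -
  have [measurable]: "h \<in> borel_measurable (Pi\<^sub>M {1..m} (\<lambda>_. borel))"
    by (rule Lambda1_measurable[OF assms])
  have [measurable]: "(\<lambda>x. \<lambda>l\<in>{1..m}. x (int l)) \<in>
      measurable (Pi\<^sub>M UNIV (\<lambda>_. borel)) (Pi\<^sub>M {1..m} (\<lambda>_. borel :: (real ^ 'p) measure))"
    by (rule measurable_restrict) simp
  have "(\<lambda>x. h (\<lambda>l\<in>{1..m}. x (int l))) \<in> borel_measurable (Pi\<^sub>M UNIV (\<lambda>_. borel))"
    by measurable
  from integral_shift[OF this, of a] show ?thesis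
    by (simp add: block_def add.commute cong: restrict_cong)
qed

section \<open>Conditioning on the past\<close>

lemma past_subalgebra: "subalgebra M (past M X)"
proof -
  have *: "{X t -` A \<inter> space M | t A. t \<le> 0 \<and> A \<in> sets borel} \<subseteq> Pow (space M)" by auto
  have "sets (past M X) \<subseteq> sets M"
    unfolding past_def sets_measure_of[OF *]
    by (rule sets.sigma_sets_subset) (auto intro: measurable_sets)
  then show ?thesis
    by (simp add: subalgebra_def past_def space_measure_of[OF *])
qed

lemma X_past_measurable: "t \<le> 0 \<Longrightarrow> X t \<in> borel_measurable (past M X)"
proof (rule measurableI)
  have *: "{X t -` A \<inter> space M | t A. t \<le> 0 \<and> A \<in> sets borel} \<subseteq> Pow (space M)" by auto
  fix A :: "(real ^ 'p) set"
  assume "A \<in> sets borel" "t \<le> 0"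
  then show "X t -` A \<inter> space (past M X) \<in> sets (past M X)"
    unfolding past_def sets_measure_of[OF *] space_measure_of[OF *] by auto
qed simp

text \<open>The supremum in \<open>theta_inf\<close> is specialised to the consecutive times
  \<open>1, \<dots>, m\<close>.\<close>

lemma past_cond_exp_le:
  assumes h: "h \<in> Lambda1 m"
  shows "AE \<omega> in M. real_cond_exp M (past M X) (\<lambda>\<omega>. h (block 0 m \<omega>)) \<omega> \<le>
    (\<integral>\<omega>. h (block 0 m \<omega>) \<partial>M) + C"
\<comment> \<open>\<open>WeakDep\<close> speaks of \<open>m > 0\<close>. The empty future, for which
  \<open>h\<close> is constant, arises at the last observation.\<close>
proof (cases "m = 0")
  case True
  interpret finite_measure_subalgebra M "past M X"
    by unfold_locales (rule past_subalgebra)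
  have "h (block 0 m \<omega>) = h (\<lambda>_. undefined)" for \<omega>
    using True by (simp add: block_def restrict_def)
  then show ?thesis
    using real_cond_exp_le_c[of "\<lambda>_. h (\<lambda>_. undefined)" "h (\<lambda>_. undefined) + C"] C
    by (simp add: prob_space)
next
  case False
  let ?D = "\<lambda>h j \<omega>. ereal
    \<bar>real_cond_exp M (past M X) (\<lambda>\<omega>'. h (\<lambda>i\<in>{1..m}. X (j i) \<omega>')) \<omega>
      - (\<integral>\<omega>'. h (\<lambda>i\<in>{1..m}. X (j i) \<omega>') \<partial>M)\<bar>"
  have "strict_mono_on {1..m} int \<and> (\<forall>i\<in>{1..m}. 0 < int i)"
    by (auto simp: strict_mono_on_def)
  then have "esssup M (?D h int) \<le> theta_inf M X m"
    unfolding theta_inf_def using h by (intro SUP_upper2[of "(h, int)"]) auto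
  also have "\<dots> \<le> ereal C" using weak_dep False by (simp add: WeakDep_def)
  finally have "esssup M (?D h int) \<le> ereal C" .
  moreover have "AE \<omega> in M. ?D h int \<omega> \<le> esssup M (?D h int)" by (rule esssup_AE)
  ultimately have "AE \<omega> in M. ?D h int \<omega> \<le> ereal C"
    by (auto elim!: eventually_mono intro: order_trans simp del: ereal_less_eq)
  moreover have "(\<lambda>\<omega>. h (\<lambda>i\<in>{1..m}. X (int i) \<omega>)) = (\<lambda>\<omega>. h (block 0 m \<omega>))"
    by (simp add: block_def)
  ultimately show ?thesis by (auto elim!: eventually_mono)
qed

text \<open>Shifting both windows back by \<open>i\<close> puts the event into the past of time 0
  and the future window at times \<open>1, \<dots>, m\<close>, where the almost sure bound on the
  conditional expectation can be integrated over the event.\<close>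

lemma weak_dependence_block:
  assumes h: "h \<in> Lambda1 m" and A [measurable]: "A \<in> sets (Pi\<^sub>M {1..i} (\<lambda>_. borel))"
  shows "(\<integral>\<omega>. indicator A (block 0 i \<omega>) * h (block (int i) m \<omega>) \<partial>M) \<le>
    prob {\<omega> \<in> space M. block 0 i \<omega> \<in> A} * ((\<integral>\<omega>. h (block 0 m \<omega>) \<partial>M) + C)"
proof -
  interpret P: finite_measure_subalgebra M "past M X"
    by unfold_locales (rule past_subalgebra)
  have [measurable]: "h \<in> borel_measurable (Pi\<^sub>M {1..m} (\<lambda>_. borel))"
    by (rule Lambda1_measurable[OF h])
  have [measurable]: "(\<lambda>x. \<lambda>l\<in>{1..m}. x (a + int l)) \<in>
      measurable (Pi\<^sub>M UNIV (\<lambda>_. borel)) (Pi\<^sub>M {1..m} (\<lambda>_. borel :: (real ^ 'p) measure))" for m a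
    by (rule measurable_restrict) simp
  let ?h = "\<lambda>\<omega>. h (block 0 m \<omega>)" and ?I = "\<lambda>\<omega>. indicat_real A (block (- int i) i \<omega>)"
  let ?E = "(\<integral>\<omega>. ?h \<omega> \<partial>M) + C"
  have IF: "?I \<in> borel_measurable (past M X)"
  proof -
    have [measurable]: "block (- int i) i \<in> measurable (past M X) (Pi\<^sub>M {1..i} (\<lambda>_. borel))"
      unfolding block_def by (intro measurable_restrict X_past_measurable) auto
    show ?thesis by measurable
  qed
  have inth: "integrable M ?h" by (rule Lambda1_block_integrable[OF h])
  have intIh: "integrable M (\<lambda>\<omega>. ?I \<omega> * ?h \<omega>)"
    by (rule Bochner_Integration.integrable_bound[OF inth])
      (use h in \<open>auto simp: indicator_def\<close>)
  have intI: "integrable M ?I"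
    by (rule integrable_const_bound[where B = 1]) auto
  have eqI: "?I = (\<lambda>\<omega>. indicat_real A (\<lambda>l\<in>{1..i}. X (int l + - int i) \<omega>))"
    by (simp add: block_def add.commute)
  have eqh: "?h = (\<lambda>\<omega>. h (\<lambda>l\<in>{1..m}. X (int i + int l + - int i) \<omega>))"
    by (simp add: block_def)
  have "(\<lambda>x. indicator A (\<lambda>l\<in>{1..i}. x (0 + int l)) * h (\<lambda>l\<in>{1..m}. x (int i + int l)))
      \<in> borel_measurable (Pi\<^sub>M UNIV (\<lambda>_. borel))"
    by measurable
  from integral_shift[OF this, of "- int i"]
  have "(\<integral>\<omega>. indicator A (block 0 i \<omega>) * h (block (int i) m \<omega>) \<partial>M) = (\<integral>\<omega>. ?I \<omega> * ?h \<omega> \<partial>M)"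
    unfolding eqI eqh by (simp add: block_def)
  also have "\<dots> = (\<integral>\<omega>. ?I \<omega> * real_cond_exp M (past M X) ?h \<omega> \<partial>M)"
    by (rule P.real_cond_exp_intg(2)[symmetric]) (use intIh IF h in auto)
  also have "\<dots> \<le> (\<integral>\<omega>. ?I \<omega> * ?E \<partial>M)"
  proof (rule integral_mono_AE)
    show "integrable M (\<lambda>\<omega>. ?I \<omega> * real_cond_exp M (past M X) ?h \<omega>)"
      by (rule P.real_cond_exp_intg(1)) (use intIh IF h in auto)
    show "AE \<omega> in M. ?I \<omega> * real_cond_exp M (past M X) ?h \<omega> \<le> ?I \<omega> * ?E"
      using past_cond_exp_le[OF h] by eventually_elim (auto intro: mult_left_mono)
  qed (use intI in auto)
  also have "\<dots> = (\<integral>\<omega>. ?I \<omega> \<partial>M) * ?E" using intI by simp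
  also have "(\<integral>\<omega>. ?I \<omega> \<partial>M) = (\<integral>\<omega>. indicat_real A (block 0 i \<omega>) \<partial>M)"
  proof -
    have "(\<lambda>x. indicat_real A (\<lambda>l\<in>{1..i}. x (0 + int l))) \<in> borel_measurable (Pi\<^sub>M UNIV (\<lambda>_. borel))"
      by measurable
    from integral_shift[OF this, of "- int i"] show ?thesis
      unfolding eqI by (simp add: block_def)
  qed
  also have "\<dots> = (\<integral>\<omega>. indicator {\<omega> \<in> space M. block 0 i \<omega> \<in> A} \<omega> \<partial>M)"
    by (intro Bochner_Integration.integral_cong) (auto simp: indicator_def)
  also have "\<dots> = prob {\<omega> \<in> space M. block 0 i \<omega> \<in> A}" by simp
  finally show ?thesis .
qed

end

section \<open>Rio's inequality\<close>

text \<open>The past \<open>q\<close> is frozen, the present value at position \<open>Suc i\<close> is replaced by \<open>0\<close> at the price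
  of at most \<open>B\<close>, and only the future \<open>v\<close> remains random.\<close>

definition glue :: "nat \<Rightarrow> nat \<Rightarrow> (nat \<Rightarrow> real ^ 'p) \<Rightarrow> (nat \<Rightarrow> real ^ 'p) \<Rightarrow> nat \<Rightarrow> real ^ 'p" where
  "glue n i q v = (\<lambda>l\<in>{1..n}. if l \<le> i then q l else if l = Suc i then 0 else v (l - Suc i))"

lemma glue_in_tuples: "glue n i q v \<in> tuples n"
  by (auto simp: glue_def)

lemma sum_glue_split:
  fixes \<phi> :: "nat \<Rightarrow> real"
  assumes "i < n"
  shows "(\<Sum>l = 1..n. \<phi> l) = (\<Sum>l = 1..i. \<phi> l) + \<phi> (Suc i) + (\<Sum>l = 1..n - Suc i. \<phi> (Suc i + l))"
proof -
  have "(\<Sum>l = 1..n. \<phi> l) = (\<Sum>l = 1..Suc i. \<phi> l) + (\<Sum>l = Suc i + 1..Suc i + (n - Suc i). \<phi> l)"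
    using sum.ub_add_nat[of 1 "Suc i" \<phi> "n - Suc i"] assms by simp
  also have "(\<Sum>l = Suc i + 1..Suc i + (n - Suc i). \<phi> l) = (\<Sum>l = 1..n - Suc i. \<phi> (Suc i + l))"
    using sum.shift_bounds_cl_nat_ivl[of \<phi> 1 "Suc i" "n - Suc i"] by (simp add: add.commute)
  finally show ?thesis by simp
qed

text \<open>This is the function of the future, for a frozen past, to which weak dependence is
  applied.\<close>

lemma Lambda1_glue_right:
  assumes h: "h \<in> Lambda1 n" and "i < n"
  shows "(\<lambda>v. h (glue n i q v)) \<in> Lambda1 (n - Suc i)"
proof -
  have "\<bar>h (glue n i q v) - h (glue n i q v')\<bar> \<le> (\<Sum>j = 1..n - Suc i. norm (v j - v' j))" for v v'
  proof -
    have "\<bar>h (glue n i q v) - h (glue n i q v')\<bar> \<le>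
        (\<Sum>l = 1..n. norm (glue n i q v l - glue n i q v' l))"
      by (intro Lambda1_D[OF h] glue_in_tuples)
    also have "\<dots> = (\<Sum>j = 1..n - Suc i. norm (v j - v' j))"
    proof -
      have "(\<Sum>l = 1..i. norm (glue n i q v l - glue n i q v' l)) = 0"
        "norm (glue n i q v (Suc i) - glue n i q v' (Suc i)) = 0"
        by (auto simp: glue_def intro!: sum.neutral)
      moreover have "norm (glue n i q v (Suc i + l) - glue n i q v' (Suc i + l)) = norm (v l - v' l)"
        if "l \<in> {1..n - Suc i}" for l
        using that \<open>i < n\<close> by (auto simp: glue_def)
      ultimately show ?thesis
        unfolding sum_glue_split[OF \<open>i < n\<close>] by simp
    qed
    finally show ?thesis .
  qed
  then show ?thesis by (simp add: Lambda1_def)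
qed

lemma Lambda1_glue_left:
  assumes h: "h \<in> Lambda1 n" and "i < n"
  shows "\<bar>h (glue n i q v) - h (glue n i q' v)\<bar> \<le> (\<Sum>l = 1..i. norm (q l - q' l))"
proof -
  have "\<bar>h (glue n i q v) - h (glue n i q' v)\<bar> \<le>
      (\<Sum>l = 1..n. norm (glue n i q v l - glue n i q' v l))"
    by (intro Lambda1_D[OF h] glue_in_tuples)
  also have "\<dots> = (\<Sum>l = 1..i. norm (q l - q' l))"
  proof -
    have "(\<Sum>l = 1..n - Suc i. norm (glue n i q v (Suc i + l) - glue n i q' v (Suc i + l))) = 0"
      "norm (glue n i q v (Suc i) - glue n i q' v (Suc i)) = 0"
      by (auto simp: glue_def intro!: sum.neutral)
    moreover have "norm (glue n i q v l - glue n i q' v l) = norm (q l - q' l)"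
      if "l \<in> {1..i}" for l
      using that \<open>i < n\<close> by (auto simp: glue_def)
    ultimately show ?thesis
      unfolding sum_glue_split[OF \<open>i < n\<close>] by simp
  qed
  finally show ?thesis .
qed

section \<open>The filtration of the observations and its martingale\<close>

context bounded_weakly_dependent
begin

text \<open>As a pulled-back algebra, all its events are preimages under \<open>block 0 i\<close>,
  which is the form of event in \<open>weak_dependence_block\<close>.\<close>

definition filtration :: "nat \<Rightarrow> 'w measure" where
  "filtration i = vimage_algebra (space M) (block 0 i) (Pi\<^sub>M {1..i} (\<lambda>_. borel))"

text \<open>The future is averaged under its unconditional law; by stationarity its window may start
  at time 1. At the actual past, this is the centre needed for the conditional Hoeffding
  lemma.\<close>

definition frozen_mean :: "nat \<Rightarrow> ((nat \<Rightarrow> real ^ 'p) \<Rightarrow> real) \<Rightarrow> nat \<Rightarrow> (nat \<Rightarrow> real ^ 'p) \<Rightarrow> real" where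
  "frozen_mean n h i q = (\<integral>\<omega>. h (glue n i q (block 0 (n - Suc i) \<omega>)) \<partial>M)"

lemma block_space: "block a m \<in> space M \<rightarrow> space (Pi\<^sub>M {1..m} (\<lambda>_. borel))"
  using block_in_tuples by (auto simp: space_PiM)

lemma sets_filtration:
  "sets (filtration i) = {block 0 i -` A \<inter> space M | A. A \<in> sets (Pi\<^sub>M {1..i} (\<lambda>_. borel))}"
  unfolding filtration_def by (rule sets_vimage_algebra2[OF block_space])

lemma space_filtration [simp]: "space (filtration i) = space M"
  by (simp add: filtration_def)

lemma block_filtration_measurable: "block 0 i \<in> measurable (filtration i) (Pi\<^sub>M {1..i} (\<lambda>_. borel))"
  unfolding filtration_def by (rule measurable_vimage_algebra1[OF block_space])

lemma filtration_subalgebra: "subalgebra M (filtration i)"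
  unfolding subalgebra_def sets_filtration
  by (auto intro: measurable_sets[OF block_measurable])

lemma filtration_mono: "subalgebra (filtration (Suc i)) (filtration i)"
proof -
  have [measurable]: "block 0 (Suc i) \<in> measurable (filtration (Suc i)) (Pi\<^sub>M {1..Suc i} (\<lambda>_. borel))"
    by (rule block_filtration_measurable)
  have "(\<lambda>\<omega>. \<lambda>l\<in>{1..i}. block 0 (Suc i) \<omega> l) \<in> measurable (filtration (Suc i)) (Pi\<^sub>M {1..i} (\<lambda>_. borel))"
    by (intro measurable_restrict measurable_compose[OF block_filtration_measurable]
        measurable_component_singleton) auto
  also have "(\<lambda>\<omega>. \<lambda>l\<in>{1..i}. block 0 (Suc i) \<omega> l) = block 0 i"
    by (auto simp: block_def fun_eq_iff)
  finally show ?thesis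
    unfolding subalgebra_def sets_filtration[of i]
    by (auto dest: measurable_sets)
qed

lemma Lambda1_frozen_mean:
  assumes h: "h \<in> Lambda1 n" and "i < n"
  shows "frozen_mean n h i \<in> Lambda1 i"
proof -
  have int: "integrable M (\<lambda>\<omega>. h (glue n i q (block 0 (n - Suc i) \<omega>)))" for q
    by (rule Lambda1_block_integrable[OF Lambda1_glue_right[OF assms]])
  have "\<bar>frozen_mean n h i q - frozen_mean n h i q'\<bar> \<le> (\<Sum>l = 1..i. norm (q l - q' l))" for q q'
  proof -
    have "\<bar>frozen_mean n h i q - frozen_mean n h i q'\<bar> =
        \<bar>\<integral>\<omega>. h (glue n i q (block 0 (n - Suc i) \<omega>)) - h (glue n i q' (block 0 (n - Suc i) \<omega>)) \<partial>M\<bar>"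
      using int by (simp add: frozen_mean_def)
    also have "\<dots> \<le> (\<integral>\<omega>. \<bar>h (glue n i q (block 0 (n - Suc i) \<omega>)) - h (glue n i q' (block 0 (n - Suc i) \<omega>))\<bar> \<partial>M)"
      by (rule integral_abs_bound)
    also have "\<dots> \<le> (\<integral>\<omega>. (\<Sum>l = 1..i. norm (q l - q' l)) \<partial>M)"
      using int by (intro integral_mono Lambda1_glue_left[OF assms]) auto
    finally show ?thesis by (simp add: prob_space)
  qed
  then show ?thesis by (simp add: Lambda1_def)
qed

text \<open>The defining property of the conditional expectation is tested on the event that the
  past is near \<open>q\<close> and the bound fails. There \<open>h\<close> is compared with its
  frozen version, and weak dependence bounds the integral of the latter, so the event must be
  null.\<close>

lemma cond_exp_le_near:
  assumes h: "h \<in> Lambda1 n" and "i < n"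
  shows "AE \<omega> in M. (\<forall>l\<in>{1..i}. norm (X (int l) \<omega> - q l) \<le> \<delta>) \<longrightarrow>
    real_cond_exp M (filtration (Suc i)) (\<lambda>\<omega>. h (block 0 n \<omega>)) \<omega>
      \<le> frozen_mean n h i q + C + B + real i * \<delta>"
proof -
  interpret F: finite_measure_subalgebra M "filtration (Suc i)"
    by unfold_locales (rule filtration_subalgebra)
  let ?Y = "\<lambda>\<omega>. h (block 0 n \<omega>)" and ?u = "frozen_mean n h i q + C + B + real i * \<delta>"
  define g where "g = real_cond_exp M (filtration (Suc i)) ?Y"
  let ?near = "\<lambda>\<omega>. \<forall>l\<in>{1..i}. norm (X (int l) \<omega> - q l) \<le> \<delta>"
  let ?hq = "\<lambda>\<omega>. h (glue n i q (block (int (Suc i)) (n - Suc i) \<omega>))"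
  have intY: "integrable M ?Y" by (rule Lambda1_block_integrable[OF h])
  have inthq: "integrable M ?hq"
    by (rule Lambda1_block_integrable[OF Lambda1_glue_right[OF assms]])
  have gF: "g \<in> borel_measurable (filtration (Suc i))" by (simp add: g_def)
  have intg: "integrable M g" unfolding g_def by (rule F.real_cond_exp_int(1)[OF intY])
  define D where "D = {\<omega> \<in> space M. ?near \<omega> \<and> ?u < g \<omega>}"
  have XF: "X (int l) \<in> borel_measurable (filtration (Suc i))" if "l \<in> {1..i}" for l
  proof -
    have "(\<lambda>\<omega>. block 0 (Suc i) \<omega> l) \<in> borel_measurable (filtration (Suc i))"
      using that by (intro measurable_compose[OF block_filtration_measurable] measurable_component_singleton) auto
    then show ?thesis using that by (simp add: block_def)
  qed
  have "D = {\<omega> \<in> space (filtration (Suc i)). ?near \<omega>} \<inter> {\<omega> \<in> space (filtration (Suc i)). ?u < g \<omega>}"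
    by (auto simp: D_def)
  also have "\<dots> \<in> sets (filtration (Suc i))"
  proof (intro sets.Int)
    show "{\<omega> \<in> space (filtration (Suc i)). ?near \<omega>} \<in> sets (filtration (Suc i))"
    \<comment> \<open>The rule for finite conjunctions is applied to a nonempty index set.\<close>
    proof (cases "i = 0")
      case True
      then show ?thesis using sets.top[of "filtration (Suc i)"] by simp
    next
      case False
      show ?thesis
      proof (rule sets.sets_Collect_finite_All')
        fix l assume "l \<in> {1..i}"
        note [measurable] = XF[OF this]
        show "{\<omega> \<in> space (filtration (Suc i)). norm (X (int l) \<omega> - q l) \<le> \<delta>} \<in> sets (filtration (Suc i))"
          by measurable
      qed (use False in auto)
    qed
    show "{\<omega> \<in> space (filtration (Suc i)). ?u < g \<omega>} \<in> sets (filtration (Suc i))"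
      using gF by measurable
  qed
  finally have DF: "D \<in> sets (filtration (Suc i))" .
  then have DM [measurable]: "D \<in> sets M"
    using filtration_subalgebra by (auto simp: subalgebra_def)
  from DF obtain A where A: "A \<in> sets (Pi\<^sub>M {1..Suc i} (\<lambda>_. borel))" "D = block 0 (Suc i) -` A \<inter> space M"
    by (auto simp: sets_filtration)
  have intD: "integrable M (\<lambda>\<omega>. indicat_real D \<omega> * U \<omega>)" if "integrable M U" for U
    using integrable_mult_indicator[OF DM that] by simp
  have "(\<integral>\<omega>. indicator D \<omega> * g \<omega> \<partial>M) = (\<integral>\<omega>. indicator D \<omega> * ?Y \<omega> \<partial>M)"
    unfolding g_def by (rule F.real_cond_exp_intg(2)) (use DF intD[OF intY] intY in auto)
  also have "\<dots> \<le> (\<integral>\<omega>. indicator D \<omega> * ?hq \<omega> + indicator D \<omega> * (B + real i * \<delta>) \<partial>M)"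
  proof (rule integral_mono_AE)
    show "AE \<omega> in M. indicator D \<omega> * ?Y \<omega> \<le> indicator D \<omega> * ?hq \<omega> + indicator D \<omega> * (B + real i * \<delta>)"
      using bounded_all
    proof eventually_elim
      case (elim \<omega>)
      show ?case
      proof (cases "\<omega> \<in> D")
        case True
        let ?d = "\<lambda>l. norm (block 0 n \<omega> l - glue n i q (block (int (Suc i)) (n - Suc i) \<omega>) l)"
        have "?Y \<omega> - ?hq \<omega> \<le> (\<Sum>l = 1..n. ?d l)"
          using Lambda1_D[OF h block_in_tuples glue_in_tuples] abs_le_D1 by blast
        \<comment> \<open>Three prices: \<open>\<delta>\<close> for each past coordinate,
          \<open>B\<close> for the present one, whose frozen value is 0, and nothing for the future,
          which is inserted unchanged from time \<open>i + 2\<close> on.\<close>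
        also have "\<dots> = (\<Sum>l = 1..i. ?d l) + ?d (Suc i) + (\<Sum>l = 1..n - Suc i. ?d (Suc i + l))"
          by (rule sum_glue_split[OF \<open>i < n\<close>])
        also have "(\<Sum>l = 1..i. ?d l) \<le> (\<Sum>l = 1..i. \<delta>)"
          using True \<open>i < n\<close> by (intro sum_mono) (auto simp: D_def block_def glue_def)
        also have "?d (Suc i) \<le> B"
          using elim \<open>i < n\<close> by (simp add: block_def glue_def)
        also have "(\<Sum>l = 1..n - Suc i. ?d (Suc i + l)) = 0"
          using \<open>i < n\<close> by (intro sum.neutral) (auto simp: block_def glue_def algebra_simps)
        finally show ?thesis using True by simp
      qed simp
    qed
  qed (intro Bochner_Integration.integrable_add intD intY inthq integrable_const)+
  also have "\<dots> = (\<integral>\<omega>. indicator D \<omega> * ?hq \<omega> \<partial>M) + prob D * (B + real i * \<delta>)"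
    by (subst Bochner_Integration.integral_add[OF intD[OF inthq] intD[OF integrable_const]]) simp
  also have "(\<integral>\<omega>. indicator D \<omega> * ?hq \<omega> \<partial>M) =
      (\<integral>\<omega>. indicator A (block 0 (Suc i) \<omega>) * ?hq \<omega> \<partial>M)"
    by (intro Bochner_Integration.integral_cong) (auto simp: A(2) indicator_def)
  \<comment> \<open>\<open>D\<close> is an event of the first \<open>Suc i\<close> observations, and
    the window in \<open>?hq\<close> starts right after them, so weak dependence costs
    \<open>C\<close>.\<close>
  also have "\<dots> \<le> prob {\<omega> \<in> space M. block 0 (Suc i) \<omega> \<in> A} * (frozen_mean n h i q + C)"
    using weak_dependence_block[OF Lambda1_glue_right[OF assms] A(1)] by (simp add: frozen_mean_def)
  also have "{\<omega> \<in> space M. block 0 (Suc i) \<omega> \<in> A} = D"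
    by (auto simp: A(2))
  finally have "(\<integral>\<omega>. indicator D \<omega> * g \<omega> \<partial>M) \<le> prob D * ?u"
    by (simp add: algebra_simps)
  moreover have "(\<integral>\<omega>. indicator D \<omega> * (g \<omega> - ?u) \<partial>M) = (\<integral>\<omega>. indicator D \<omega> * g \<omega> \<partial>M) - prob D * ?u"
    unfolding right_diff_distrib
    by (subst Bochner_Integration.integral_diff[OF intD[OF intg] intD[OF integrable_const]]) simp
  \<comment> \<open>On \<open>D\<close> the integrand is positive and elsewhere it is 0, so this
    makes \<open>D\<close> a null set.\<close>
  ultimately have "(\<integral>\<omega>. indicator D \<omega> * (g \<omega> - ?u) \<partial>M) \<le> 0"
    by simp
  moreover have nn: "0 \<le> indicator D \<omega> * (g \<omega> - ?u)" for \<omega>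
    by (auto simp: D_def indicator_def)
  ultimately have "(\<integral>\<omega>. indicator D \<omega> * (g \<omega> - ?u) \<partial>M) = 0"
    by (intro antisym Bochner_Integration.integral_nonneg)
  then have "AE \<omega> in M. indicator D \<omega> * (g \<omega> - ?u) = 0"
    by (subst (asm) integral_nonneg_eq_0_iff_AE)
      (use nn intg in \<open>auto intro!: intD\<close>)
  then show ?thesis
    using AE_space
  proof eventually_elim
    case (elim \<omega>)
    then show ?case by (auto simp: D_def indicator_def g_def split: if_splits)
  qed
qed

text \<open>Weak dependence only controls fixed Lipschitz functions, almost surely. It is applied to a
  countable dense set of frozen pasts \<open>q\<close>, and the Lipschitz dependence on \<open>q\<close> then allows to put
  the actual past in place of \<open>q\<close>.\<close>

lemma cond_exp_le_frozen_mean: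
  assumes h: "h \<in> Lambda1 n" and "i < n"
  shows "AE \<omega> in M. real_cond_exp M (filtration (Suc i)) (\<lambda>\<omega>. h (block 0 n \<omega>)) \<omega>
      \<le> frozen_mean n h i (block 0 i \<omega>) + (B + C)"
proof -
  obtain D :: "(real ^ 'p) set" where D: "countable D" "\<And>U. open U \<Longrightarrow> U \<noteq> {} \<Longrightarrow> \<exists>d\<in>D. d \<in> U"
    using countable_dense_exists by metis
  define Q where "Q = PiE {1..i} (\<lambda>_. D)"
  have "countable Q" unfolding Q_def by (intro countable_PiE D) auto
  let ?g = "real_cond_exp M (filtration (Suc i)) (\<lambda>\<omega>. h (block 0 n \<omega>))"
  have "AE \<omega> in M. \<forall>q\<in>Q. \<forall>N. (\<forall>l\<in>{1..i}. norm (X (int l) \<omega> - q l) \<le> 1 / real (Suc N)) \<longrightarrow>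
      ?g \<omega> \<le> frozen_mean n h i q + C + B + real i * (1 / real (Suc N))"
    using cond_exp_le_near[OF assms] by (intro AE_ball_countable' \<open>countable Q\<close> AE_all_countable[THEN iffD2] allI)
  then show ?thesis
  proof eventually_elim
    case (elim \<omega>)
    show ?case
    proof (rule field_le_epsilon)
      fix e :: real assume "0 < e"
      \<comment> \<open>The error \<open>i * \<delta>\<close> occurs twice, once for nearness to
        \<open>q\<close> and once for moving \<open>frozen_mean\<close> back to the actual past. The
        summand 1 in the denominator covers \<open>i = 0\<close>.\<close>
      then obtain N where N: "1 / real (Suc N) < e / (2 * real i + 1)"
        using reals_Archimedean[of "e / (2 * real i + 1)"] by (auto simp: inverse_eq_divide)
      define \<delta> where "\<delta> = 1 / real (Suc N)"
      have "0 < \<delta>" by (simp add: \<delta>_def)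
      have "\<exists>d\<in>D. d \<in> ball (X (int l) \<omega>) \<delta>" for l
        using \<open>0 < \<delta>\<close> by (intro D) auto
      then obtain d where d: "\<And>l. d l \<in> D" "\<And>l. d l \<in> ball (X (int l) \<omega>) \<delta>" by metis
      define q where "q = (\<lambda>l\<in>{1..i}. d l)"
      have near: "norm (X (int l) \<omega> - q l) \<le> \<delta>" if "l \<in> {1..i}" for l
        using d(2)[of l] that by (simp add: q_def dist_norm less_imp_le)
      have "q \<in> Q" using d(1) by (auto simp: q_def Q_def)
      then have "?g \<omega> \<le> frozen_mean n h i q + C + B + real i * \<delta>"
        using elim near by (auto simp: \<delta>_def)
      also have "frozen_mean n h i q - frozen_mean n h i (block 0 i \<omega>) \<le> (\<Sum>l = 1..i. norm (q l - block 0 i \<omega> l))"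
        using Lambda1_D[OF Lambda1_frozen_mean[OF assms], of q "block 0 i \<omega>"] block_in_tuples[of 0 i \<omega>]
        by (auto simp: q_def)
      then have "frozen_mean n h i q \<le> frozen_mean n h i (block 0 i \<omega>) + (\<Sum>l = 1..i. norm (q l - block 0 i \<omega> l))"
        by simp
      also have "(\<Sum>l = 1..i. norm (q l - block 0 i \<omega> l)) \<le> (\<Sum>l = 1..i. \<delta>)"
        using near by (intro sum_mono) (auto simp: block_def norm_minus_commute)
      also have "\<dots> = real i * \<delta>" by simp
      finally have "?g \<omega> \<le> frozen_mean n h i (block 0 i \<omega>) + (B + C) + 2 * real i * \<delta>" by (simp add: algebra_simps)
      also have "2 * real i * \<delta> \<le> (2 * real i + 1) * \<delta>" using \<open>0 < \<delta>\<close> by (simp add: algebra_simps)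
      also have "\<dots> \<le> e" using N by (simp add: \<delta>_def field_simps)
      finally show "?g \<omega> \<le> frozen_mean n h i (block 0 i \<omega>) + (B + C) + e" by simp
    qed
  qed
qed

text \<open>The lower bound is the upper bound for \<open>- h\<close>, which has the same Lipschitz
  property.\<close>

lemma cond_exp_near_frozen_mean:
  assumes h: "h \<in> Lambda1 n" and "i < n"
  shows "AE \<omega> in M. \<bar>real_cond_exp M (filtration (Suc i)) (\<lambda>\<omega>. h (block 0 n \<omega>)) \<omega>
      - frozen_mean n h i (block 0 i \<omega>)\<bar> \<le> B + C"
proof -
  interpret F: finite_measure_subalgebra M "filtration (Suc i)"
    by unfold_locales (rule filtration_subalgebra)
  let ?g = "\<lambda>h. real_cond_exp M (filtration (Suc i)) (\<lambda>\<omega>. h (block 0 n \<omega>))"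
  have gneg: "AE \<omega> in M. ?g (\<lambda>u. - h u) \<omega> = - ?g h \<omega>"
    using F.real_cond_exp_cmult[OF Lambda1_block_integrable[OF h, of 0], where c = "-1"] by simp
  have neg: "frozen_mean n (\<lambda>u. - h u) i q = - frozen_mean n h i q" for q
    by (simp add: frozen_mean_def)
  show ?thesis
    using gneg cond_exp_le_frozen_mean[OF assms] cond_exp_le_frozen_mean[OF Lambda1_uminus[OF h] \<open>i < n\<close>]
    by eventually_elim (simp add: abs_le_iff neg)
qed

text \<open>While \<open>g (Suc i)\<close> depends on \<open>Suc i\<close> observations, its centre
  \<open>frozen_mean\<close> depends on the first \<open>i\<close> only. So the conditional
  Hoeffding lemma applies with half-width \<open>B + C\<close>, and the tower property turns the
  conditional expectation of \<open>g (Suc i)\<close> into \<open>g i\<close>.\<close>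

lemma Rio_step:
  assumes h: "h \<in> Lambda1 n" and "i < n"
  defines "g \<equiv> \<lambda>i. real_cond_exp M (filtration i) (\<lambda>\<omega>. h (block 0 n \<omega>))"
  shows "(\<integral>\<omega>. exp (s * g (Suc i) \<omega>) \<partial>M) \<le>
    exp (s\<^sup>2 * (B + C)\<^sup>2 / 2) * (\<integral>\<omega>. exp (s * g i \<omega>) \<partial>M)"
proof -
  interpret S: finite_measure_subalgebra M "filtration (Suc i)"
    by unfold_locales (rule filtration_subalgebra)
  interpret F: finite_measure_subalgebra M "filtration i"
    by unfold_locales (rule filtration_subalgebra)
  have int: "integrable M (\<lambda>\<omega>. h (block 0 n \<omega>))" by (rule Lambda1_block_integrable[OF h])
  let ?b = "\<bar>h (\<lambda>l\<in>{1..n}. 0)\<bar> + real n * B"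
  have "AE \<omega> in M. g (Suc i) \<omega> \<le> ?b" "AE \<omega> in M. - ?b \<le> g (Suc i) \<omega>"
    unfolding g_def by (intro S.real_cond_exp_le_c S.real_cond_exp_ge_c int;
        use AE_Lambda1_bounded[OF h, of 0] in eventually_elim; simp)+
  then have bnd: "AE \<omega> in M. \<bar>g (Suc i) \<omega>\<bar> \<le> ?b" by eventually_elim simp
  have "(\<integral>\<omega>. exp (s * g (Suc i) \<omega>) \<partial>M) \<le>
      exp (s\<^sup>2 * (B + C)\<^sup>2 / 2) * (\<integral>\<omega>. exp (s * real_cond_exp M (filtration i) (g (Suc i)) \<omega>) \<partial>M)"
  proof (rule conditional_Hoeffding[OF filtration_subalgebra _ bnd])
    show "(\<lambda>\<omega>. frozen_mean n h i (block 0 i \<omega>)) \<in> borel_measurable (filtration i)"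
      by (rule measurable_compose[OF block_filtration_measurable
            Lambda1_measurable[OF Lambda1_frozen_mean[OF h \<open>i < n\<close>]]])
    show "AE \<omega> in M. \<bar>g (Suc i) \<omega> - frozen_mean n h i (block 0 i \<omega>)\<bar> \<le> B + C"
      unfolding g_def by (rule cond_exp_near_frozen_mean[OF h \<open>i < n\<close>])
  qed (use B C in \<open>auto simp: g_def\<close>)
  also have "(\<integral>\<omega>. exp (s * real_cond_exp M (filtration i) (g (Suc i)) \<omega>) \<partial>M) = (\<integral>\<omega>. exp (s * g i \<omega>) \<partial>M)"
  proof (rule integral_cong_AE)
    have "AE \<omega> in M. real_cond_exp M (filtration i) (g (Suc i)) \<omega> = g i \<omega>"
      unfolding g_def
      by (rule F.real_cond_exp_nested_subalg[OF filtration_subalgebra filtration_mono int])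
    then show "AE \<omega> in M. exp (s * real_cond_exp M (filtration i) (g (Suc i)) \<omega>) = exp (s * g i \<omega>)"
      by eventually_elim simp
  qed (auto simp: g_def)
  finally show ?thesis .
qed

text \<open>The steps are chained from \<open>g n\<close>, the function itself, down to
  \<open>g 0\<close>, its mean; each contributes one exponential factor.\<close>

lemma Rio_inequality:
  assumes h: "h \<in> Lambda1 n"
  shows "(\<integral>\<omega>. exp (s * (h (block 0 n \<omega>) - (\<integral>\<omega>. h (block 0 n \<omega>) \<partial>M))) \<partial>M) \<le>
    exp (s\<^sup>2 * real n * (B + C)\<^sup>2 / 2)"
proof -
  let ?Y = "\<lambda>\<omega>. h (block 0 n \<omega>)"
  let ?m = "\<integral>\<omega>. ?Y \<omega> \<partial>M"
  define g where "g = (\<lambda>i. real_cond_exp M (filtration i) ?Y)"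
  have int: "integrable M ?Y" by (rule Lambda1_block_integrable[OF h])
  have g0: "AE \<omega> in M. g 0 \<omega> = ?m"
  proof -
    interpret F: finite_measure_subalgebra M "filtration 0"
      by unfold_locales (rule filtration_subalgebra)
    have "(\<integral>\<omega>\<in>A. ?Y \<omega> \<partial>M) = (\<integral>\<omega>\<in>A. ?m \<partial>M)" if "A \<in> sets (filtration 0)" for A
    proof -
      \<comment> \<open>The empty block is a constant map, so \<open>filtration 0\<close> is
        trivial.\<close>
      have "block 0 0 = (\<lambda>\<omega> _. undefined)" by (simp add: block_def fun_eq_iff)
      then have "A = {} \<or> A = space M"
        using that by (auto simp: sets_filtration split: if_splits)
      then show ?thesis
        by (auto simp: set_lebesgue_integral_def prob_space intro!: Bochner_Integration.integral_cong)
    qed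
    then show ?thesis unfolding g_def by (rule F.real_cond_exp_charact) (use int in auto)
  qed
  have gn: "AE \<omega> in M. g n \<omega> = ?Y \<omega>"
  proof -
    interpret F: finite_measure_subalgebra M "filtration n"
      by unfold_locales (rule filtration_subalgebra)
    show ?thesis unfolding g_def
      by (rule F.real_cond_exp_F_meas[OF int
            measurable_compose[OF block_filtration_measurable Lambda1_measurable[OF h]]])
  qed
  have gM [measurable]: "g i \<in> borel_measurable M" for i by (simp add: g_def)
  have iter: "(\<integral>\<omega>. exp (s * g i \<omega>) \<partial>M) \<le> exp (s\<^sup>2 * (B + C)\<^sup>2 / 2) ^ i * exp (s * ?m)" if "i \<le> n" for i
    using that
  proof (induction i)
    case 0
    have "(\<integral>\<omega>. exp (s * g 0 \<omega>) \<partial>M) = (\<integral>\<omega>. exp (s * ?m) \<partial>M)"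
      by (rule integral_cong_AE) (use g0 in auto)
    then show ?case by (simp add: prob_space)
  next
    case (Suc i)
    have "(\<integral>\<omega>. exp (s * g (Suc i) \<omega>) \<partial>M) \<le> exp (s\<^sup>2 * (B + C)\<^sup>2 / 2) * (\<integral>\<omega>. exp (s * g i \<omega>) \<partial>M)"
      unfolding g_def by (rule Rio_step[OF h]) (use Suc in auto)
    also have "\<dots> \<le> exp (s\<^sup>2 * (B + C)\<^sup>2 / 2) * (exp (s\<^sup>2 * (B + C)\<^sup>2 / 2) ^ i * exp (s * ?m))"
      using Suc by (intro mult_left_mono) auto
    finally show ?case by (simp add: mult.assoc)
  qed
  have "(\<integral>\<omega>. exp (s * (?Y \<omega> - ?m)) \<partial>M) = (\<integral>\<omega>. exp (s * g n \<omega>) * exp (- s * ?m) \<partial>M)"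
  proof (rule integral_cong_AE)
    show "AE \<omega> in M. exp (s * (?Y \<omega> - ?m)) = exp (s * g n \<omega>) * exp (- s * ?m)"
      using gn by eventually_elim (simp add: right_diff_distrib flip: exp_add)
  qed (use h in measurable)
  also have "\<dots> = (\<integral>\<omega>. exp (s * g n \<omega>) \<partial>M) * exp (- s * ?m)" by simp
  also have "\<dots> \<le> exp (s\<^sup>2 * (B + C)\<^sup>2 / 2) ^ n * exp (s * ?m) * exp (- s * ?m)"
    using iter[of n] by (intro mult_right_mono) auto
  also have "\<dots> = exp (s\<^sup>2 * real n * (B + C)\<^sup>2 / 2)"
    by (simp add: mult.assoc exp_of_nat_mult[symmetric] flip: exp_add)
  finally show ?thesis .
qed

end

section \<open>PAC-Bayesian bounds\<close>

text \<open>With \<open>D\<close> the density of \<open>N\<close>, the function \<open>E / S\<close>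
  has \<open>N\<close>-mean at most 1, and integrating \<open>ln y \<le> y - 1\<close> at
  \<open>y = E x / S\<close> gives the claim.\<close>

lemma (in prob_space) Donsker_Varadhan:
  assumes N: "prob_space N" "sets N = sets M" and ac: "absolutely_continuous M N"
    and kl: "integrable N (entropy_density (exp 1) M N)"
    and [measurable]: "\<psi> \<in> borel_measurable M" and int: "integrable N \<psi>"
    and exp: "integrable M (\<lambda>x. exp (\<psi> x))"
  shows "(\<integral>x. \<psi> x \<partial>N) - KL_divergence (exp 1) M N \<le> ln (\<integral>x. exp (\<psi> x) \<partial>M)"
proof -
  interpret N: prob_space N by (rule N(1))
  obtain D where D [measurable]: "D \<in> borel_measurable M"
    and DM: "AE x in M. RN_deriv M N x = ennreal (D x)"
    and DN: "AE x in N. 0 < D x" and D0: "\<And>x. 0 \<le> D x"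
    using real_RN_deriv[OF N.finite_measure_axioms ac N(2)] by metis
  define S where "S = (\<integral>x. exp (\<psi> x) \<partial>M)"
  have S: "0 < S" unfolding S_def by (rule expectation_greater[OF exp]) simp
  define E where "E = (\<lambda>x. exp (\<psi> x) / D x)"
  have [measurable]: "E \<in> borel_measurable M" by (simp add: E_def)
  have EN [measurable]: "E \<in> borel_measurable N" "\<psi> \<in> borel_measurable N" "D \<in> borel_measurable N"
    by (simp_all add: measurable_cong_sets[OF N(2) refl])
  have E0: "0 \<le> E x" for x by (simp add: E_def D0)
  have "(\<integral>\<^sup>+x. ennreal (E x) \<partial>N) = (\<integral>\<^sup>+x. RN_deriv M N x * ennreal (E x) \<partial>M)"
    by (rule RN_deriv_nn_integral[OF ac N(2)]) simp
  \<comment> \<open>This is an inequality because \<open>D\<close> may vanish on a set of positive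
    \<open>M\<close>-measure, where \<open>E\<close> is 0 by the convention on division.\<close>
  also have "\<dots> \<le> (\<integral>\<^sup>+x. ennreal (exp (\<psi> x)) \<partial>M)"
  proof (rule nn_integral_mono_AE)
    show "AE x in M. RN_deriv M N x * ennreal (E x) \<le> ennreal (exp (\<psi> x))"
      using DM by eventually_elim (auto simp: E_def D0 ennreal_mult[symmetric] intro!: ennreal_leI)
  qed
  also have "\<dots> = ennreal S"
    unfolding S_def by (rule nn_integral_eq_integral[OF exp]) simp
  finally have le: "(\<integral>\<^sup>+x. ennreal (E x) \<partial>N) \<le> ennreal S" .
  then have intE: "integrable N E"
    by (intro integrableI_nonneg) (auto simp: E0 intro: le_less_trans)
  have ES: "(\<integral>x. E x \<partial>N) \<le> S"
    using le S by (simp add: nn_integral_eq_integral[OF intE] E0)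
  have ent: "AE x in N. entropy_density (exp 1) M N x = ln (D x)"
    using absolutely_continuous_AE[OF N(2) ac DM]
    by eventually_elim (simp add: entropy_density_def D0 log_def)
  have "(\<integral>x. \<psi> x - entropy_density (exp 1) M N x - ln S \<partial>N) \<le> (\<integral>x. E x / S - 1 \<partial>N)"
  proof (rule integral_mono_AE)
    show "AE x in N. \<psi> x - entropy_density (exp 1) M N x - ln S \<le> E x / S - 1"
      using ent DN
    proof eventually_elim
      case (elim x)
      have "ln (E x / S) \<le> E x / S - 1"
        using S elim by (intro ln_le_minus_one) (simp add: E_def)
      moreover have "ln (E x / S) = \<psi> x - ln (D x) - ln S"
        using S elim by (simp add: E_def ln_div ln_mult)
      ultimately show ?case using elim by simp
    qed
  qed (use int kl intE in auto)
  also have "\<dots> = (\<integral>x. E x \<partial>N) / S - 1"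
    using intE by (simp add: N.prob_space)
  also have "\<dots> \<le> 0" using ES S by simp
  finally show ?thesis
    using int kl by (simp add: N.prob_space KL_divergence_def S_def)
qed

text \<open>Jensen's inequality, via the tangent of the exponential at the mean \<open>a\<close>.
  The nonnegative integral in the hypothesis also yields integrability of the exponential.\<close>

lemma (in prob_space) exp_expectation_le:
  fixes Y :: "'a \<Rightarrow> real"
  assumes Y: "integrable M Y" and le: "(\<integral>\<^sup>+x. ennreal (exp (Y x)) \<partial>M) \<le> ennreal c" and c: "0 < c"
  shows "(\<integral>x. Y x \<partial>M) \<le> ln c"
proof -
  define a where "a = (\<integral>x. Y x \<partial>M)"
  have [measurable]: "Y \<in> borel_measurable M" using Y by auto
  have int: "integrable M (\<lambda>x. exp (Y x))"
    using le by (intro integrableI_nonneg) (auto intro: le_less_trans)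
  have "exp a = (\<integral>x. exp a * (1 + (Y x - a)) \<partial>M)"
    using Y by (simp add: prob_space a_def)
  also have "\<dots> \<le> (\<integral>x. exp (Y x) \<partial>M)"
  proof (rule integral_mono)
    fix x
    have "exp a * (1 + (Y x - a)) \<le> exp a * exp (Y x - a)"
      by (intro mult_left_mono exp_ge_add_one_self) auto
    then show "exp a * (1 + (Y x - a)) \<le> exp (Y x)"
      by (simp flip: exp_add)
  qed (use Y int in auto)
  also have "\<dots> \<le> c"
    using le c by (simp add: nn_integral_eq_integral[OF int])
  finally show ?thesis using c by (simp add: a_def ln_ge_iff)
qed

text \<open>The deterministic part, for one fixed outcome: \<open>M\<close> is the prior,
  \<open>r\<close> the empirical risk as a function of the parameter, and \<open>R\<close> the
  risk.\<close>

locale gibbs = prob_space M for M :: "'b measure" +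
  fixes r R :: "'b \<Rightarrow> real" and lam :: real
  assumes r [measurable]: "r \<in> borel_measurable M" and r0: "\<And>x. 0 \<le> r x"
    and R [measurable]: "R \<in> borel_measurable M" and R0: "\<And>x. 0 \<le> R x"
    and lam: "0 < lam"
begin

definition Z :: real where "Z = (\<integral>x. exp (- lam * r x) \<partial>M)"

abbreviation post :: "'b measure" where "post \<equiv> gibbs_posterior M r lam"

lemma integrable_weight: "integrable M (\<lambda>x. exp (- lam * r x))"
  by (rule integrable_const_bound[where B = 1]) (use lam r0 in auto)

lemma Z_pos: "0 < Z"
  unfolding Z_def by (rule expectation_greater[OF integrable_weight]) simp

lemma post_eq: "post = density M (\<lambda>x. ennreal (exp (- lam * r x) / Z))"
  by (simp add: gibbs_posterior_def Z_def)

lemma sets_post [measurable_cong, simp]: "sets post = sets M"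
  by (simp add: post_eq)

lemma space_post [simp]: "space post = space M"
  by (simp add: post_eq)

lemma prob_space_post: "prob_space post"
proof
  have "emeasure post (space post) = (\<integral>\<^sup>+x. ennreal (exp (- lam * r x) / Z) \<partial>M)"
    by (simp add: post_eq emeasure_density cong: nn_integral_cong)
  also have "\<dots> = ennreal (\<integral>x. exp (- lam * r x) / Z \<partial>M)"
    using integrable_weight Z_pos by (intro nn_integral_eq_integral) auto
  also have "\<dots> = 1"
    using Z_pos by (simp add: Z_def)
  finally show "emeasure post (space post) = 1" .
qed

text \<open>The posterior density absorbs \<open>exp (- lam * r x)\<close>, so the hypothesis is a
  bound on the posterior integral of \<open>exp (lam * R x - V + ln Z)\<close>, to which Jensen's
  inequality applies.\<close>

lemma posterior_risk_bound:
  assumes le: "(\<integral>\<^sup>+x. ennreal (exp (lam * (R x - r x) - V)) \<partial>M) \<le> ennreal c" and c: "0 < c"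
  shows "integrable post R" and "lam * (\<integral>x. R x \<partial>post) \<le> V + ln c - ln Z"
proof -
  interpret P: prob_space post by (rule prob_space_post)
  have "(\<integral>\<^sup>+x. ennreal (exp (lam * R x - V + ln Z)) \<partial>post) =
      (\<integral>\<^sup>+x. ennreal (exp (lam * (R x - r x) - V)) \<partial>M)"
    unfolding post_eq
  proof (subst nn_integral_density)
    show "(\<integral>\<^sup>+x. ennreal (exp (- lam * r x) / Z) * ennreal (exp (lam * R x - V + ln Z)) \<partial>M) =
        (\<integral>\<^sup>+x. ennreal (exp (lam * (R x - r x) - V)) \<partial>M)"
      using Z_pos
      by (intro nn_integral_cong)
        (simp add: ennreal_mult[symmetric] exp_add exp_diff exp_minus field_simps)
  qed auto
  then have le': "(\<integral>\<^sup>+x. ennreal (exp (lam * R x - V + ln Z)) \<partial>post) \<le> ennreal c"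
    using le by simp
  then have int: "integrable post (\<lambda>x. exp (lam * R x - V + ln Z))"
    by (intro integrableI_nonneg) (auto intro: le_less_trans)
  show intR: "integrable post R"
  proof (rule Bochner_Integration.integrable_bound)
    \<comment> \<open>By \<open>1 + y \<le> exp y\<close> this integrable function dominates
      \<open>R\<close>.\<close>
    show "integrable post (\<lambda>x. (exp (lam * R x - V + ln Z) + \<bar>V\<bar> + \<bar>ln Z\<bar>) / lam)"
      using int by simp
    show "AE x in post. norm (R x) \<le> norm ((exp (lam * R x - V + ln Z) + \<bar>V\<bar> + \<bar>ln Z\<bar>) / lam)"
    proof (rule AE_I2)
      fix x
      have "lam * R x \<le> exp (lam * R x - V + ln Z) + \<bar>V\<bar> + \<bar>ln Z\<bar>"
        using exp_ge_add_one_self[of "lam * R x - V + ln Z"] by linarith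
      then have "R x \<le> (exp (lam * R x - V + ln Z) + \<bar>V\<bar> + \<bar>ln Z\<bar>) / lam"
        using lam by (simp add: field_simps)
      then show "norm (R x) \<le> norm ((exp (lam * R x - V + ln Z) + \<bar>V\<bar> + \<bar>ln Z\<bar>) / lam)"
        using R0[of x] lam by simp
    qed
  qed simp
  have "(\<integral>x. lam * R x - V + ln Z \<partial>post) \<le> ln c"
    by (rule P.exp_expectation_le[OF _ le' c]) (use intR in auto)
  then show "lam * (\<integral>x. R x \<partial>post) \<le> V + ln c - ln Z"
    using intR P.prob_space by simp
qed

text \<open>By Cauchy--Schwarz, \<open>r\<close> cancels between \<open>exp (- lam * r)\<close> and \<open>exp (lam * (r - R))\<close>, so that
  \<open>r\<close> need not be integrable with respect to \<open>N\<close>.\<close>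

lemma free_energy_bound:
  assumes le: "(\<integral>\<^sup>+x. ennreal (exp (lam * (r x - R x) - V)) \<partial>M) \<le> ennreal c" and c: "0 < c"
    and N: "prob_space N" "sets N = sets M" "absolutely_continuous M N"
      "integrable N (entropy_density (exp 1) M N)"
    and intR: "integrable N R"
  shows "- ln Z \<le> lam * (\<integral>x. R x \<partial>N) + 2 * KL_divergence (exp 1) M N + V + ln c"
proof -
  interpret N: prob_space N by (rule N(1))
  \<comment> \<open>The average of the exponents \<open>- lam * r x\<close> and
    \<open>lam * (r x - R x) - V\<close>. The squares in Cauchy--Schwarz restore the two, and the
    resulting \<open>2 * ln T\<close> puts the factor 2 before the divergence.\<close>
  define \<psi> where "\<psi> = (\<lambda>x. - lam * R x / 2 - V / 2)"
  have \<psi> [measurable]: "\<psi> \<in> borel_measurable M" by (simp add: \<psi>_def)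
  define T where "T = (\<integral>x. exp (\<psi> x) \<partial>M)"
  have int: "integrable M (\<lambda>x. exp (\<psi> x))"
  proof (rule integrable_const_bound[where B = "exp (- V / 2)"])
    show "AE x in M. norm (exp (\<psi> x)) \<le> exp (- V / 2)"
      using lam R0 by (auto simp: \<psi>_def)
  qed simp
  have T: "0 < T" unfolding T_def by (rule expectation_greater[OF int]) simp
  let ?a = "\<lambda>x. ennreal (exp (- lam * r x / 2))" and ?b = "\<lambda>x. ennreal (exp ((lam * (r x - R x) - V) / 2))"
  have sq: "exp (y / 2) * exp (y / 2) = exp y" for y :: real
    by (simp flip: exp_add)
  have "(ennreal T)\<^sup>2 = (\<integral>\<^sup>+x. ?a x * ?b x \<partial>M)\<^sup>2"
  proof -
    have "(\<integral>\<^sup>+x. ?a x * ?b x \<partial>M) = (\<integral>\<^sup>+x. ennreal (exp (\<psi> x)) \<partial>M)"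
      by (intro nn_integral_cong)
        (simp add: ennreal_mult[symmetric] exp_add[symmetric] \<psi>_def field_simps)
    also have "\<dots> = ennreal T"
      unfolding T_def by (rule nn_integral_eq_integral[OF int]) simp
    finally show ?thesis by simp
  qed
  also have "\<dots> \<le> (\<integral>\<^sup>+x. ?a x ^ 2 \<partial>M) * (\<integral>\<^sup>+x. ?b x ^ 2 \<partial>M)"
    by (rule Cauchy_Schwarz_nn_integral) auto
  also have "(\<integral>\<^sup>+x. ?a x ^ 2 \<partial>M) = (\<integral>\<^sup>+x. ennreal (exp (- lam * r x)) \<partial>M)"
    using sq[of "- lam * r _"] by (intro nn_integral_cong) (simp add: power2_eq_square ennreal_mult[symmetric])
  also have "\<dots> = ennreal Z"
    unfolding Z_def by (rule nn_integral_eq_integral[OF integrable_weight]) simp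
  also have "(\<integral>\<^sup>+x. ?b x ^ 2 \<partial>M) = (\<integral>\<^sup>+x. ennreal (exp (lam * (r x - R x) - V)) \<partial>M)"
    using sq[of "lam * (r _ - R _) - V"] by (intro nn_integral_cong) (simp only: power2_eq_square ennreal_mult[symmetric] exp_ge_zero)
  also have "ennreal Z * (\<integral>\<^sup>+x. ennreal (exp (lam * (r x - R x) - V)) \<partial>M) \<le> ennreal Z * ennreal c"
    by (intro mult_left_mono le) simp
  also have "\<dots> = ennreal (Z * c)" using Z_pos c by (simp add: ennreal_mult)
  finally have "T\<^sup>2 \<le> Z * c"
    using T Z_pos c by (simp add: ennreal_power)
  then have "ln (T\<^sup>2) \<le> ln (Z * c)"
    using T Z_pos c by (subst ln_le_cancel_iff) auto
  then have "2 * ln T \<le> ln Z + ln c"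
    using T Z_pos c by (simp add: ln_mult ln_realpow)
  moreover have "(\<integral>x. \<psi> x \<partial>N) - KL_divergence (exp 1) M N \<le> ln T"
    unfolding T_def by (rule Donsker_Varadhan[OF N]) (use intR int in \<open>auto simp: \<psi>_def\<close>)
  moreover have "(\<integral>x. \<psi> x \<partial>N) = - lam * (\<integral>x. R x \<partial>N) / 2 - V / 2"
    using intR by (simp add: \<psi>_def N.prob_space)
  ultimately show ?thesis by linarith
qed

end

text \<open>By Fubini the random integral has mean at most 1, and Markov's inequality is applied at
  level \<open>2 / \<epsilon>\<close>. Each of the two bad events used later gets half of
  \<open>\<epsilon>\<close>.\<close>

lemma (in prob_space) prob_nn_integral_ge:
  assumes N: "prob_space N" and W [measurable]: "(\<lambda>(x, \<omega>). W x \<omega>) \<in> borel_measurable (N \<Otimes>\<^sub>M M)"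
    and le: "\<And>x. x \<in> space N \<Longrightarrow> (\<integral>\<^sup>+\<omega>. W x \<omega> \<partial>M) \<le> 1" and \<epsilon>: "0 < \<epsilon>"
  shows "prob {\<omega> \<in> space M. ennreal (2 / \<epsilon>) \<le> (\<integral>\<^sup>+x. W x \<omega> \<partial>N)} \<le> \<epsilon> / 2"
proof -
  interpret N: prob_space N by (rule N)
  interpret pair_sigma_finite N M ..
  have [measurable]: "(\<lambda>\<omega>. \<integral>\<^sup>+x. W x \<omega> \<partial>N) \<in> borel_measurable M"
    by measurable
  have "emeasure M {\<omega> \<in> space M. ennreal (2 / \<epsilon>) \<le> (\<integral>\<^sup>+x. W x \<omega> \<partial>N)}
      = emeasure M {\<omega> \<in> space M. 1 \<le> ennreal (\<epsilon> / 2) * (\<integral>\<^sup>+x. W x \<omega> \<partial>N)}"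
  proof (intro arg_cong[where f = "emeasure M"] Collect_cong conj_cong refl)
    fix \<omega>
    let ?y = "\<integral>\<^sup>+x. W x \<omega> \<partial>N"
    have "ennreal (\<epsilon> / 2) * ennreal (2 / \<epsilon>) = 1" "ennreal (2 / \<epsilon>) * ennreal (\<epsilon> / 2) = 1"
      using \<epsilon> by (simp_all add: ennreal_mult[symmetric])
    then show "ennreal (2 / \<epsilon>) \<le> ?y \<longleftrightarrow> 1 \<le> ennreal (\<epsilon> / 2) * ?y"
      by (metis mult.assoc mult.right_neutral mult.left_neutral mult_left_mono zero_le)
  qed
  also have "\<dots> \<le> ennreal (\<epsilon> / 2) * (\<integral>\<^sup>+\<omega>. (\<integral>\<^sup>+x. W x \<omega> \<partial>N) * indicator (space M) \<omega> \<partial>M)"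
    using nn_integral_Markov_inequality[of "\<lambda>\<omega>. \<integral>\<^sup>+x. W x \<omega> \<partial>N" "space M" M "ennreal (\<epsilon> / 2)"]
    by simp
  also have "(\<integral>\<^sup>+\<omega>. (\<integral>\<^sup>+x. W x \<omega> \<partial>N) * indicator (space M) \<omega> \<partial>M) = (\<integral>\<^sup>+\<omega>. (\<integral>\<^sup>+x. W x \<omega> \<partial>N) \<partial>M)"
    by (intro nn_integral_cong) simp
  also have "\<dots> = (\<integral>\<^sup>+x. (\<integral>\<^sup>+\<omega>. W x \<omega> \<partial>M) \<partial>N)"
    by (rule Fubini'[OF W])
  also have "ennreal (\<epsilon> / 2) * \<dots> \<le> ennreal (\<epsilon> / 2) * (\<integral>\<^sup>+x. 1 \<partial>N)"
    by (intro mult_left_mono nn_integral_mono le) simp_all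
  finally have "emeasure M {\<omega> \<in> space M. ennreal (2 / \<epsilon>) \<le> (\<integral>\<^sup>+x. W x \<omega> \<partial>N)} \<le> ennreal (\<epsilon> / 2)"
    by (simp add: N.emeasure_space_1)
  then show ?thesis
    using \<epsilon> by (simp add: emeasure_eq_measure)
qed

section \<open>Predictors and their risks\<close>

locale forecasting = bounded_weakly_dependent M X B C
  for M :: "'w measure" and X :: "int \<Rightarrow> 'w \<Rightarrow> real ^ 'p" and B C :: real +
  fixes \<pi> :: "'b::{real_vector, topological_space} measure" and k :: nat
    and f :: "'b \<Rightarrow> (nat \<Rightarrow> real ^ 'p) \<Rightarrow> real ^ 'p"
    and loss :: "real ^ 'p \<Rightarrow> real ^ 'p \<Rightarrow> real" and g :: "real ^ 'p \<Rightarrow> real" and K L :: real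
  assumes prior: "prob_space \<pi>"
    and linear_f: "\<And>x. x \<in> tuples k \<Longrightarrow> linear (\<lambda>\<theta>. f \<theta> x) \<and> continuous_on UNIV (\<lambda>\<theta>. f \<theta> x)"
    and f_measurable [measurable]:
      "(\<lambda>(\<theta>, x). f \<theta> x) \<in> borel_measurable (\<pi> \<Otimes>\<^sub>M Pi\<^sub>M {1..k} (\<lambda>_. borel))"
    and K: "0 < K" and L: "0 < L"
    and loss_eq: "\<And>x x'. loss x x' = g (x - x')"
    and g_convex: "convex_on UNIV g" and g_Lipschitz: "K-lipschitz_on UNIV g"
    and g_nonneg: "\<And>x. 0 \<le> g x" and g_0: "g 0 = 0"
    and f_Lip: "Lip L k (space \<pi>) f"
begin

sublocale \<pi>: prob_space \<pi> by (rule prior)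

section \<open>Lipschitz constants of the loss, the predictors and the empirical risk\<close>

lemma g_diff_le: "\<bar>g x - g y\<bar> \<le> K * norm (x - y)"
  using lipschitz_onD[OF g_Lipschitz, of x y] by (simp add: dist_norm)

lemma g_le: "\<bar>g x\<bar> \<le> K * norm x"
  using g_diff_le[of x 0] by (simp add: g_0)

lemma g_continuous: "continuous_on UNIV g"
  by (rule lipschitz_on_continuous_on[OF g_Lipschitz])

lemma g_measurable [measurable]: "g \<in> borel_measurable borel"
  by (rule borel_measurable_continuous_onI[OF g_continuous])

text \<open>Coefficients satisfying \<open>Lip\<close> are automatically nonnegative: test the
  inequality on two tuples that differ by a unit vector at position \<open>j\<close> only.\<close>

lemma f_Lipschitz_coeffs:
  assumes "\<theta> \<in> space \<pi>"
  obtains a where "\<And>j. j \<in> {1..k} \<Longrightarrow> 0 \<le> a j" "(\<Sum>j = 1..k. a j) \<le> L"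
    "\<And>x y. x \<in> tuples k \<Longrightarrow> y \<in> tuples k \<Longrightarrow> norm (f \<theta> x - f \<theta> y) \<le> (\<Sum>j = 1..k. a j * norm (x j - y j))"
proof -
  obtain a where a1: "(\<Sum>j = 1..k. a j) \<le> L"
    and a2: "\<forall>x\<in>tuples k. \<forall>y\<in>tuples k. norm (f \<theta> x - f \<theta> y) \<le> (\<Sum>j = 1..k. a j * norm (x j - y j))"
    using bspec[OF f_Lip[unfolded Lip_def] assms] by (elim exE conjE)
  have "0 \<le> a j" if j: "j \<in> {1..k}" for j
  proof -
    let ?x = "\<lambda>l\<in>{1..k}. if l = j then axis undefined 1 else 0 :: real ^ 'p"
    let ?y = "\<lambda>l\<in>{1..k}. 0 :: real ^ 'p"
    have "0 \<le> (\<Sum>l = 1..k. a l * norm (?x l - ?y l))"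
      by (rule order_trans[OF norm_ge_zero bspec[OF bspec[OF a2]]]) auto
    also have "\<dots> = (\<Sum>l = 1..k. if l = j then a j else 0)"
      by (intro sum.cong) (auto simp: norm_axis_1)
    also have "\<dots> = a j" using j by simp
    finally show ?thesis .
  qed
  then show ?thesis using a1 a2 by (intro that[of a]) auto
qed

text \<open>For \<open>m = n\<close> this is the unnormalised empirical risk, for
  \<open>m = k + 1\<close> a single loss. The difference \<open>i - j\<close> never truncates, since
  \<open>j \<le> k < i\<close>.\<close>

definition loss_sum :: "'b \<Rightarrow> nat \<Rightarrow> (nat \<Rightarrow> real ^ 'p) \<Rightarrow> real" where
  "loss_sum \<theta> m x = (\<Sum>i = k + 1..m. loss (f \<theta> (\<lambda>j\<in>{1..k}. x (i - j))) (x i))"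

definition loss_at :: "'b \<Rightarrow> int \<Rightarrow> 'w \<Rightarrow> real" where
  "loss_at \<theta> s \<omega> = loss (prediction X k f \<theta> s \<omega>) (X s \<omega>)"

lemma loss_at_nonneg: "0 \<le> loss_at \<theta> s \<omega>"
  by (simp add: loss_at_def loss_eq g_nonneg)

text \<open>Each coordinate enters at most once as a target, with weight 1, and at most once at each
  lag \<open>j\<close>, with weight \<open>a j\<close>. The total weight is at most
  \<open>1 + L\<close>, and \<open>g\<close> contributes the factor \<open>K\<close>.\<close>

lemma Lambda1_loss_sum:
  assumes \<theta>: "\<theta> \<in> space \<pi>"
  shows "(\<lambda>x. loss_sum \<theta> m x / (K * (1 + L))) \<in> Lambda1 m"
proof -
  obtain a where a: "\<And>j. j \<in> {1..k} \<Longrightarrow> 0 \<le> a j" "(\<Sum>j = 1..k. a j) \<le> L"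
    "\<And>x y. x \<in> tuples k \<Longrightarrow> y \<in> tuples k \<Longrightarrow> norm (f \<theta> x - f \<theta> y) \<le> (\<Sum>j = 1..k. a j * norm (x j - y j))"
    by (rule f_Lipschitz_coeffs[OF \<theta>]) (rule that)
  have diff_le: "\<bar>loss_sum \<theta> m u - loss_sum \<theta> m v\<bar> \<le> K * (1 + L) * (\<Sum>l = 1..m. norm (u l - v l))" for u v
  proof -
    define d where "d = (\<lambda>l. norm (u l - v l))"
    define D where "D = (\<Sum>l = 1..m. d l)"
    have d0: "0 \<le> d l" for l by (simp add: d_def)
    have D0: "0 \<le> D" by (simp add: D_def d0 sum_nonneg)
    \<comment> \<open>Shifting by a lag is injective and stays inside \<open>{1..m}\<close>; lag 0
      accounts for the targets.\<close>
    have shift: "(\<Sum>i = k + 1..m. d (i - j)) \<le> D" if "j \<le> k" for j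
    proof -
      have "inj_on (\<lambda>i. i - j) {k + 1..m}" using that by (auto simp: inj_on_def)
      then have "(\<Sum>i = k + 1..m. d (i - j)) = sum d ((\<lambda>i. i - j) ` {k + 1..m})"
        by (simp add: sum.reindex)
      also have "\<dots> \<le> D"
        unfolding D_def using that by (intro sum_mono2) (auto simp: d0)
      finally show ?thesis .
    qed
    let ?p = "\<lambda>u i. \<lambda>j\<in>{1..k}. u (i - j)"
    have "\<bar>loss_sum \<theta> m u - loss_sum \<theta> m v\<bar> \<le>
        (\<Sum>i = k + 1..m. \<bar>loss (f \<theta> (?p u i)) (u i) - loss (f \<theta> (?p v i)) (v i)\<bar>)"
      unfolding loss_sum_def sum_subtractf[symmetric] by (rule sum_abs)
    also have "\<dots> \<le> (\<Sum>i = k + 1..m. K * ((\<Sum>j = 1..k. a j * d (i - j)) + d i))"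
    proof (rule sum_mono)
      fix i
      have "norm (f \<theta> (?p u i) - f \<theta> (?p v i)) \<le> (\<Sum>j = 1..k. a j * norm (?p u i j - ?p v i j))"
        by (rule a(3)) auto
      also have "\<dots> = (\<Sum>j = 1..k. a j * d (i - j))"
        by (intro sum.cong) (auto simp: d_def)
      finally have f_le: "norm (f \<theta> (?p u i) - f \<theta> (?p v i)) \<le> (\<Sum>j = 1..k. a j * d (i - j))" .
      have "norm ((f \<theta> (?p u i) - u i) - (f \<theta> (?p v i) - v i))
          = norm ((f \<theta> (?p u i) - f \<theta> (?p v i)) - (u i - v i))"
        by (rule arg_cong[where f = norm]) simp
      also have "\<dots> \<le> norm (f \<theta> (?p u i) - f \<theta> (?p v i)) + d i"
        unfolding d_def by (rule norm_triangle_ineq4)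
      also have "\<dots> \<le> (\<Sum>j = 1..k. a j * d (i - j)) + d i"
        by (rule add_right_mono[OF f_le])
      finally have "norm ((f \<theta> (?p u i) - u i) - (f \<theta> (?p v i) - v i)) \<le> (\<Sum>j = 1..k. a j * d (i - j)) + d i" .
      then show "\<bar>loss (f \<theta> (?p u i)) (u i) - loss (f \<theta> (?p v i)) (v i)\<bar>
          \<le> K * ((\<Sum>j = 1..k. a j * d (i - j)) + d i)"
        unfolding loss_eq by (rule order_trans[OF g_diff_le mult_left_mono]) (use K in simp)
    qed
    also have "\<dots> = K * ((\<Sum>j = 1..k. a j * (\<Sum>i = k + 1..m. d (i - j))) + (\<Sum>i = k + 1..m. d i))"
    proof -
      have "(\<Sum>i = k + 1..m. \<Sum>j = 1..k. a j * d (i - j)) = (\<Sum>j = 1..k. \<Sum>i = k + 1..m. a j * d (i - j))"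
        by (rule sum.swap)
      then show ?thesis
        by (simp only: sum_distrib_left[symmetric] sum.distrib)
    qed
    also have "\<dots> \<le> K * (L * D + D)"
    proof (intro mult_left_mono add_mono)
      have "(\<Sum>j = 1..k. a j * (\<Sum>i = k + 1..m. d (i - j))) \<le> (\<Sum>j = 1..k. a j * D)"
        by (intro sum_mono mult_left_mono shift a) auto
      also have "\<dots> \<le> L * D"
        using a(2) D0 by (simp add: sum_distrib_right[symmetric] mult_right_mono)
      finally show "(\<Sum>j = 1..k. a j * (\<Sum>i = k + 1..m. d (i - j))) \<le> L * D" .
      show "(\<Sum>i = k + 1..m. d i) \<le> D" using shift[of 0] by simp
    qed (use K in simp)
    finally show ?thesis by (simp add: D_def d_def algebra_simps)
  qed
  have c: "0 < K * (1 + L)" using K L by simp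
  have "\<bar>loss_sum \<theta> m u / (K * (1 + L)) - loss_sum \<theta> m v / (K * (1 + L))\<bar> \<le> (\<Sum>l = 1..m. norm (u l - v l))" for u v
  proof -
    have "\<bar>loss_sum \<theta> m u / (K * (1 + L)) - loss_sum \<theta> m v / (K * (1 + L))\<bar>
        = \<bar>loss_sum \<theta> m u - loss_sum \<theta> m v\<bar> / (K * (1 + L))"
      using c by (simp only: diff_divide_distrib[symmetric] abs_divide abs_of_pos)
    also have "\<dots> \<le> (\<Sum>l = 1..m. norm (u l - v l))"
      using diff_le[of u v] c by (simp only: pos_divide_le_eq mult.commute)
    finally show ?thesis .
  qed
  then show ?thesis by (simp add: Lambda1_def)
qed

lemma loss_sum_block:
  "loss_sum \<theta> m (block a m \<omega>) = (\<Sum>i = k + 1..m. loss_at \<theta> (a + int i) \<omega>)"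
  unfolding loss_sum_def loss_at_def
proof (intro sum.cong refl)
  fix i assume i: "i \<in> {k + 1..m}"
  have "(\<lambda>j\<in>{1..k}. block a m \<omega> (i - j)) = (\<lambda>j\<in>{1..k}. X (a + int i - int j) \<omega>)"
    using i by (intro restrict_ext) (auto simp: block_def of_nat_diff algebra_simps)
  moreover have "block a m \<omega> i = X (a + int i) \<omega>" using i by (simp add: block_def)
  ultimately show "loss (f \<theta> (\<lambda>j\<in>{1..k}. block a m \<omega> (i - j))) (block a m \<omega> i)
      = loss (prediction X k f \<theta> (a + int i) \<omega>) (X (a + int i) \<omega>)"
    by (simp add: prediction_def)
qed

text \<open>A window of length \<open>k + 1\<close> that ends at time \<open>s\<close> leaves
  exactly one term in \<open>loss_sum\<close>.\<close>

lemma loss_at_eq_block: "loss_at \<theta> s \<omega> = loss_sum \<theta> (k + 1) (block (s - int (k + 1)) (k + 1) \<omega>)"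
  unfolding loss_sum_block by simp

text \<open>A single loss is a rescaled Lipschitz function of a window, so it is integrable and, by
  stationarity, its mean does not depend on time.\<close>

lemma
  assumes \<theta>: "\<theta> \<in> space \<pi>"
  shows integrable_loss_at: "integrable M (loss_at \<theta> s)"
    and expectation_loss_at: "(\<integral>\<omega>. loss_at \<theta> s \<omega> \<partial>M) = risk M X k f loss t \<theta>"
proof -
  let ?c = "K * (1 + L)"
  have c: "?c \<noteq> 0" using K L by simp
  note h = Lambda1_loss_sum[OF \<theta>, of "k + 1"]
  have eq: "loss_at \<theta> s = (\<lambda>\<omega>. ?c * (loss_sum \<theta> (k + 1) (block (s - int (k + 1)) (k + 1) \<omega>) / ?c))" for s
    using c by (auto simp: loss_at_eq_block fun_eq_iff simp del: of_nat_Suc of_nat_add)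
  show "integrable M (loss_at \<theta> s)"
    unfolding eq by (intro integrable_mult_right Lambda1_block_integrable[OF h])
  have E: "(\<integral>\<omega>. loss_at \<theta> s \<omega> \<partial>M) = ?c * (\<integral>\<omega>. loss_sum \<theta> (k + 1) (block 0 (k + 1) \<omega>) / ?c \<partial>M)" for s
    unfolding eq expectation_block_shift[OF h, symmetric, of "s - int (k + 1)"]
    by (rule integral_mult_right_zero)
  show "(\<integral>\<omega>. loss_at \<theta> s \<omega> \<partial>M) = risk M X k f loss t \<theta>"
    using E[of s] E[of t] by (simp add: risk_def loss_at_def)
qed

lemma risk_nonneg: "0 \<le> risk M X k f loss t \<theta>"
  unfolding risk_def by (simp add: loss_eq g_nonneg)

text \<open>Rio's inequality for the normalised loss sum. The sign of \<open>s\<close> is free, so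
  both deviations of the empirical risk are covered.\<close>

lemma exp_moment:
  assumes \<theta>: "\<theta> \<in> space \<pi>" and n: "k < n"
  defines "\<kappa> \<equiv> K * (1 + L) * (B + C) / sqrt 2"
  shows "(\<integral>\<^sup>+\<omega>. ennreal (exp (s * (risk M X k f loss t \<theta> - empirical_risk X n k f loss \<theta> \<omega>)
      - s\<^sup>2 * \<kappa>\<^sup>2 / (real n * (1 - real k / real n)\<^sup>2))) \<partial>M) \<le> 1"
proof -
  define h where "h = (\<lambda>x. loss_sum \<theta> n x / (K * (1 + L)))"
  have h: "h \<in> Lambda1 n" unfolding h_def by (rule Lambda1_loss_sum[OF \<theta>])
  define V where "V = s\<^sup>2 * \<kappa>\<^sup>2 / (real n * (1 - real k / real n)\<^sup>2)"
  define c where "c = K * (1 + L) / (real n - real k)"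
  have nk: "0 < real n - real k" using n by simp
  have emp: "empirical_risk X n k f loss \<theta> \<omega> = c * h (block 0 n \<omega>)" for \<omega>
    using K L by (simp add: empirical_risk_def h_def c_def loss_sum_block loss_at_def)
  have risk: "risk M X k f loss t \<theta> = c * (\<integral>\<omega>. h (block 0 n \<omega>) \<partial>M)"
  proof -
    have "(\<integral>\<omega>. loss_sum \<theta> n (block 0 n \<omega>) \<partial>M) = (\<Sum>i = k + 1..n. \<integral>\<omega>. loss_at \<theta> (0 + int i) \<omega> \<partial>M)"
      unfolding loss_sum_block
      by (rule Bochner_Integration.integral_sum) (rule integrable_loss_at[OF \<theta>])
    also have "\<dots> = (real n - real k) * risk M X k f loss t \<theta>"
      using n by (simp add: expectation_loss_at[OF \<theta>, of _ t] of_nat_diff)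
    finally show ?thesis
      using nk K L by (simp add: h_def c_def)
  qed
  \<comment> \<open>The \<open>sqrt 2\<close> in \<open>\<kappa>\<close> absorbs the
    \<open>1 / 2\<close> of Rio's inequality, and \<open>n / (n - k)\<^sup>2\<close> is the
    reciprocal of \<open>n (1 - k / n)\<^sup>2\<close>.\<close>
  have V: "(- s * c)\<^sup>2 * real n * (B + C)\<^sup>2 / 2 = V"
  proof -
    have k2: "\<kappa>\<^sup>2 = (K * (1 + L) * (B + C))\<^sup>2 / 2" by (simp add: \<kappa>_def power_divide)
    have V_eq: "real n * (1 - real k / real n)\<^sup>2 = (real n - real k)\<^sup>2 / real n"
      using n by (simp add: power2_eq_square field_simps)
    show ?thesis
      unfolding V_def V_eq k2 c_def by (simp add: power_mult_distrib power_divide mult_ac)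
  qed
  let ?Y = "\<lambda>\<omega>. h (block 0 n \<omega>) - (\<integral>\<omega>. h (block 0 n \<omega>) \<partial>M)"
  \<comment> \<open>Rio's inequality bounds a Bochner integral; integrability transfers the bound to
    the nonnegative integral.\<close>
  have int: "integrable M (\<lambda>\<omega>. exp (- s * c * ?Y \<omega>))"
  proof -
    let ?b = "\<bar>h (\<lambda>l\<in>{1..n}. 0)\<bar> + real n * B + \<bar>\<integral>\<omega>. h (block 0 n \<omega>) \<partial>M\<bar>"
    have [measurable]: "(\<lambda>\<omega>. h (block 0 n \<omega>)) \<in> borel_measurable M" using h by measurable
    show ?thesis
    proof (rule integrable_const_bound[where B = "exp (\<bar>- s * c\<bar> * ?b)"])
      show "AE \<omega> in M. norm (exp (- s * c * ?Y \<omega>)) \<le> exp (\<bar>- s * c\<bar> * ?b)"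
        using AE_Lambda1_bounded[OF h, of 0]
      proof eventually_elim
        case (elim \<omega>)
        have "- s * c * ?Y \<omega> \<le> \<bar>- s * c\<bar> * \<bar>?Y \<omega>\<bar>" by (simp only: abs_mult[symmetric] abs_ge_self)
        also have "\<dots> \<le> \<bar>- s * c\<bar> * ?b" using elim by (intro mult_left_mono) auto
        finally show ?case by simp
      qed
    qed simp
  qed
  have "(\<integral>\<^sup>+\<omega>. ennreal (exp (s * (risk M X k f loss t \<theta> - empirical_risk X n k f loss \<theta> \<omega>) - V)) \<partial>M)
      = (\<integral>\<^sup>+\<omega>. ennreal (exp (- V) * exp (- s * c * ?Y \<omega>)) \<partial>M)"
    by (intro nn_integral_cong arg_cong[where f = ennreal])
      (simp add: emp risk algebra_simps flip: exp_add)
  also have "\<dots> = ennreal (\<integral>\<omega>. exp (- V) * exp (- s * c * ?Y \<omega>) \<partial>M)"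
    using int by (intro nn_integral_eq_integral) auto
  also have "(\<integral>\<omega>. exp (- V) * exp (- s * c * ?Y \<omega>) \<partial>M) \<le> exp (- V) * exp V"
    using Rio_inequality[OF h, of "- s * c"] unfolding V by simp
  also have "ennreal (exp (- V) * exp V) = 1" by (simp flip: exp_add)
  finally show ?thesis by (simp add: V_def ennreal_leI)
qed

section \<open>Joint measurability, and averaging of predictors\<close>

lemma prediction_arguments_measurable [measurable]:
  "(\<lambda>\<omega>. \<lambda>j\<in>{1..k}. X (s - int j) \<omega>) \<in> measurable M (Pi\<^sub>M {1..k} (\<lambda>_. borel))"
  by (intro measurable_restrict) simp

lemma loss_at_measurable [measurable]:
  "(\<lambda>(\<theta>, \<omega>). loss_at \<theta> s \<omega>) \<in> borel_measurable (\<pi> \<Otimes>\<^sub>M M)"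
proof -
  have "(\<lambda>z. (\<lambda>(\<theta>, x). f \<theta> x) (fst z, \<lambda>j\<in>{1..k}. X (s - int j) (snd z))) \<in> borel_measurable (\<pi> \<Otimes>\<^sub>M M)"
    by measurable
  then have [measurable]: "(\<lambda>z. f (fst z) (\<lambda>j\<in>{1..k}. X (s - int j) (snd z))) \<in> borel_measurable (\<pi> \<Otimes>\<^sub>M M)"
    by simp
  show ?thesis
    unfolding loss_at_def loss_eq prediction_def case_prod_beta by measurable
qed

lemma empirical_risk_measurable [measurable]:
  "(\<lambda>(\<theta>, \<omega>). empirical_risk X n k f loss \<theta> \<omega>) \<in> borel_measurable (\<pi> \<Otimes>\<^sub>M M)"
proof -
  have [measurable]: "(\<lambda>z. loss_at (fst z) s (snd z)) \<in> borel_measurable (\<pi> \<Otimes>\<^sub>M M)" for s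
    using loss_at_measurable[of s] by (simp add: case_prod_beta)
  show ?thesis
    unfolding empirical_risk_def loss_at_def[symmetric] case_prod_beta by measurable
qed

lemma risk_measurable [measurable]: "risk M X k f loss t \<in> borel_measurable \<pi>"
proof -
  have "(\<lambda>\<theta>. \<integral>\<omega>. loss_at \<theta> t \<omega> \<partial>M) \<in> borel_measurable \<pi>" by measurable
  then show ?thesis by (simp add: risk_def[abs_def] loss_at_def)
qed

text \<open>Each coordinate of \<open>\<lambda>\<theta>. f \<theta> x\<close> is a continuous linear
  functional, hence one of those tested by the weak mean.\<close>

lemma prediction_mean:
  assumes mean: "is_mean N m" and x: "x \<in> tuples k"
  shows "integrable N (\<lambda>\<theta>. f \<theta> x)" and "f m x = (\<integral>\<theta>. f \<theta> x \<partial>N)"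
proof -
  have coord: "integrable N (\<lambda>\<theta>. f \<theta> x \<bullet> b) \<and> f m x \<bullet> b = (\<integral>\<theta>. f \<theta> x \<bullet> b \<partial>N)" for b
  proof -
    have "linear (\<lambda>\<theta>. f \<theta> x \<bullet> b)"
      using linear_compose[of "\<lambda>\<theta>. f \<theta> x" "\<lambda>y. y \<bullet> b"] linear_f[OF x]
      by (simp add: comp_def bounded_linear.linear bounded_linear_inner_left)
    moreover have "continuous_on UNIV (\<lambda>\<theta>. f \<theta> x \<bullet> b)"
      using linear_f[OF x] by (intro continuous_intros) auto
    ultimately show ?thesis using mean unfolding is_mean_def by blast
  qed
  have "integrable N (\<lambda>\<theta>. \<Sum>b\<in>Basis. (f \<theta> x \<bullet> b) *\<^sub>R b)"
    using coord by (intro Bochner_Integration.integrable_sum integrable_scaleR_left) auto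
  then show int: "integrable N (\<lambda>\<theta>. f \<theta> x)"
    by (simp add: euclidean_representation)
  show "f m x = (\<integral>\<theta>. f \<theta> x \<partial>N)"
    by (rule euclidean_eqI) (use coord int in simp)
qed

text \<open>Jensen's inequality is applied at each outcome, where the prediction at \<open>m\<close>
  is the mean prediction, and then integrated with Fubini. Nonnegative integrals are used because
  \<open>m\<close> may lie outside \<open>space \<pi>\<close>, where integrability of the loss is
  not known.\<close>

lemma risk_mean_le:
  assumes N: "prob_space N" and sets [measurable_cong]: "sets N = sets \<pi>"
    and mean: "is_mean N m" and int: "integrable N (risk M X k f loss t)"
  shows "risk M X k f loss t m \<le> (\<integral>\<theta>. risk M X k f loss t \<theta> \<partial>N)"
proof -
  interpret N: prob_space N by (rule N)
  interpret NM: pair_sigma_finite N M ..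
  let ?R = "risk M X k f loss t"
  have space: "space N = space \<pi>" by (rule sets_eq_imp_space_eq[OF sets])
  have [measurable]: "(\<lambda>(\<theta>, \<omega>). loss_at \<theta> t \<omega>) \<in> borel_measurable (N \<Otimes>\<^sub>M M)"
    using loss_at_measurable[of t]
    by (simp add: measurable_cong_sets[OF sets_pair_measure_cong[OF sets refl] refl])
  have Jensen: "ennreal (loss_at m t \<omega>) \<le> (\<integral>\<^sup>+\<theta>. ennreal (loss_at \<theta> t \<omega>) \<partial>N)" if \<omega>: "\<omega> \<in> space M" for \<omega>
  proof -
    let ?x = "\<lambda>j\<in>{1..k}. X (t - int j) \<omega>"
    have x: "?x \<in> tuples k" by auto
    note m = prediction_mean[OF mean x]
    let ?Y = "\<lambda>\<theta>. f \<theta> ?x - X t \<omega>"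
    have intY: "integrable N ?Y" using m(1) by simp
    have intg: "integrable N (\<lambda>\<theta>. g (?Y \<theta>))"
    proof (rule Bochner_Integration.integrable_bound)
      show "integrable N (\<lambda>\<theta>. K *\<^sub>R ?Y \<theta>)" using intY by simp
      show "AE \<theta> in N. norm (g (?Y \<theta>)) \<le> norm (K *\<^sub>R ?Y \<theta>)"
        using g_le K by simp
    qed (use intY in measurable)
    have "loss_at m t \<omega> = g (\<integral>\<theta>. ?Y \<theta> \<partial>N)"
      using m by (simp add: loss_at_def loss_eq prediction_def N.prob_space)
    also have "\<dots> \<le> (\<integral>\<theta>. g (?Y \<theta>) \<partial>N)"
      by (rule N.Jensen_euclidean[OF intY intg g_convex g_continuous])
    also have "(\<lambda>\<theta>. g (?Y \<theta>)) = (\<lambda>\<theta>. loss_at \<theta> t \<omega>)"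
      by (simp add: loss_at_def loss_eq prediction_def)
    finally have "ennreal (loss_at m t \<omega>) \<le> ennreal (\<integral>\<theta>. loss_at \<theta> t \<omega> \<partial>N)"
      by (rule ennreal_leI)
    also have "\<dots> = (\<integral>\<^sup>+\<theta>. ennreal (loss_at \<theta> t \<omega>) \<partial>N)"
      using intg loss_at_nonneg
      by (intro nn_integral_eq_integral[symmetric]) (auto simp: loss_at_def loss_eq prediction_def)
    finally show ?thesis .
  qed
  have "(\<integral>\<^sup>+\<omega>. ennreal (loss_at m t \<omega>) \<partial>M) \<le> (\<integral>\<^sup>+\<omega>. (\<integral>\<^sup>+\<theta>. ennreal (loss_at \<theta> t \<omega>) \<partial>N) \<partial>M)"
    by (rule nn_integral_mono) (rule Jensen)
  also have "\<dots> = (\<integral>\<^sup>+\<theta>. (\<integral>\<^sup>+\<omega>. ennreal (loss_at \<theta> t \<omega>) \<partial>M) \<partial>N)"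
    by (rule NM.Fubini') measurable
  also have "\<dots> = (\<integral>\<^sup>+\<theta>. ennreal (?R \<theta>) \<partial>N)"
  proof (rule nn_integral_cong)
    fix \<theta> assume "\<theta> \<in> space N"
    then have "\<theta> \<in> space \<pi>" by (simp add: space)
    then show "(\<integral>\<^sup>+\<omega>. ennreal (loss_at \<theta> t \<omega>) \<partial>M) = ennreal (?R \<theta>)"
      using integrable_loss_at[of \<theta> t] expectation_loss_at[of \<theta> t t] loss_at_nonneg
      by (subst nn_integral_eq_integral) auto
  qed
  also have "\<dots> = ennreal (\<integral>\<theta>. ?R \<theta> \<partial>N)"
    using risk_nonneg by (intro nn_integral_eq_integral[OF int]) auto
  finally have le: "(\<integral>\<^sup>+\<omega>. ennreal (loss_at m t \<omega>) \<partial>M) \<le> ennreal (\<integral>\<theta>. ?R \<theta> \<partial>N)" .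
  have R: "?R m = (\<integral>\<omega>. loss_at m t \<omega> \<partial>M)" by (simp add: risk_def loss_at_def)
  have nn: "0 \<le> (\<integral>\<theta>. ?R \<theta> \<partial>N)" by (simp add: risk_nonneg)
  show ?thesis
  proof (cases "integrable M (loss_at m t)")
    case True
    then have "ennreal (?R m) \<le> ennreal (\<integral>\<theta>. ?R \<theta> \<partial>N)"
      unfolding R using le by (subst nn_integral_eq_integral[symmetric]) (auto simp: loss_at_nonneg)
    then show ?thesis using nn by simp
  next
    \<comment> \<open>Here the Bochner integral defining \<open>?R m\<close> is 0 by
      convention.\<close>
    case False
    then show ?thesis using nn unfolding R by (simp add: not_integrable_integral_eq)
  qed
qed

lemma empirical_risk_measurable_section:
  "\<omega> \<in> space M \<Longrightarrow> (\<lambda>\<theta>. empirical_risk X n k f loss \<theta> \<omega>) \<in> borel_measurable \<pi>"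
  using measurable_compose[OF measurable_Pair2' empirical_risk_measurable] by simp

lemma empirical_risk_nonneg: "k < n \<Longrightarrow> 0 \<le> empirical_risk X n k f loss \<theta> \<omega>"
  unfolding empirical_risk_def by (intro divide_nonneg_nonneg sum_nonneg) (auto simp: loss_eq g_nonneg)

lemma gibbs_empirical:
  "k < n \<Longrightarrow> 0 < lam \<Longrightarrow> \<omega> \<in> space M \<Longrightarrow>
    gibbs \<pi> (\<lambda>\<theta>. empirical_risk X n k f loss \<theta> \<omega>) (risk M X k f loss t) lam"
  by unfold_locales
    (auto simp: empirical_risk_measurable_section empirical_risk_nonneg risk_nonneg risk_measurable)

text \<open>The map \<open>\<theta>hat\<close> is only specified outcome by outcome. Its
  predictions, however, are posterior means of predictions, that is, integrals against the fixed
  prior of a jointly measurable function.\<close>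

lemma risk_estimator_measurable:
  assumes mean: "\<And>\<omega>. \<omega> \<in> space M \<Longrightarrow>
    is_mean (gibbs_posterior \<pi> (\<lambda>\<theta>. empirical_risk X n k f loss \<theta> \<omega>) lam) (\<theta>hat \<omega>)"
  shows "(\<lambda>\<omega>. risk M X k f loss t (\<theta>hat \<omega>)) \<in> borel_measurable M"
proof -
  define r where "r = (\<lambda>\<omega> \<theta>. empirical_risk X n k f loss \<theta> \<omega>)"
  \<comment> \<open>The Gibbs density, which moves the dependence on \<open>\<omega>\<close> from
    the measure into the integrand.\<close>
  define w where "w = (\<lambda>\<omega> \<theta>. exp (- lam * r \<omega> \<theta>) / (\<integral>\<theta>'. exp (- lam * r \<omega> \<theta>') \<partial>\<pi>))"
  define x where "x = (\<lambda>\<omega>. \<lambda>j\<in>{1..k}. X (t - int j) \<omega>)"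
  define F where "F = (\<lambda>\<omega> \<omega>'. g ((\<integral>\<theta>. w \<omega> \<theta> *\<^sub>R f \<theta> (x \<omega>') \<partial>\<pi>) - X t \<omega>'))"
  have x [measurable]: "x \<in> measurable M (Pi\<^sub>M {1..k} (\<lambda>_. borel))"
    unfolding x_def by measurable
  have r [measurable]: "(\<lambda>(\<omega>, \<theta>). r \<omega> \<theta>) \<in> borel_measurable (M \<Otimes>\<^sub>M \<pi>)"
    using measurable_compose[OF measurable_pair_swap' empirical_risk_measurable[of n]]
    by (simp add: r_def case_prod_beta)
  have [measurable]: "(\<lambda>\<omega>. \<integral>\<theta>'. exp (- lam * r \<omega> \<theta>') \<partial>\<pi>) \<in> borel_measurable M"
    by measurable
  have w: "(\<lambda>(\<omega>, \<theta>). w \<omega> \<theta>) \<in> borel_measurable (M \<Otimes>\<^sub>M \<pi>)"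
    unfolding w_def by measurable
  have 1: "(\<lambda>p. (fst (fst p), snd p)) \<in> measurable ((M \<Otimes>\<^sub>M M) \<Otimes>\<^sub>M \<pi>) (M \<Otimes>\<^sub>M \<pi>)"
    and 2: "(\<lambda>p. (snd p, x (snd (fst p)))) \<in> measurable ((M \<Otimes>\<^sub>M M) \<Otimes>\<^sub>M \<pi>) (\<pi> \<Otimes>\<^sub>M Pi\<^sub>M {1..k} (\<lambda>_. borel))"
    by measurable
  have [measurable]: "(\<lambda>(z, \<theta>). w (fst z) \<theta> *\<^sub>R f \<theta> (x (snd z))) \<in> borel_measurable ((M \<Otimes>\<^sub>M M) \<Otimes>\<^sub>M \<pi>)"
    using measurable_compose[OF 1 w] measurable_compose[OF 2 f_measurable]
    by (simp add: case_prod_beta)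
  have "(\<lambda>z. \<integral>\<theta>. w (fst z) \<theta> *\<^sub>R f \<theta> (x (snd z)) \<partial>\<pi>) \<in> borel_measurable (M \<Otimes>\<^sub>M M)"
    by measurable
  then have [measurable]: "(\<lambda>(\<omega>, \<omega>'). F \<omega> \<omega>') \<in> borel_measurable (M \<Otimes>\<^sub>M M)"
    unfolding F_def case_prod_beta by measurable
  have "(\<lambda>\<omega>. \<integral>\<omega>'. F \<omega> \<omega>' \<partial>M) \<in> borel_measurable M" by measurable
  moreover have "risk M X k f loss t (\<theta>hat \<omega>) = (\<integral>\<omega>'. F \<omega> \<omega>' \<partial>M)" if \<omega>: "\<omega> \<in> space M" for \<omega>
    unfolding risk_def
  proof (rule Bochner_Integration.integral_cong[OF refl])
    fix \<omega>' assume \<omega>': "\<omega>' \<in> space M"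
    have x': "x \<omega>' \<in> tuples k" by (auto simp: x_def)
    have [measurable]: "w \<omega> \<in> borel_measurable \<pi>"
      using measurable_compose[OF measurable_Pair1'[OF \<omega>] w] by simp
    have "x \<omega>' \<in> space (Pi\<^sub>M {1..k} (\<lambda>_. borel))" using x' by (simp add: space_PiM)
    then have f: "(\<lambda>\<theta>. f \<theta> (x \<omega>')) \<in> borel_measurable \<pi>"
      using measurable_compose[OF measurable_Pair2' f_measurable] by simp
    have "f (\<theta>hat \<omega>) (x \<omega>') = (\<integral>\<theta>. f \<theta> (x \<omega>') \<partial>density \<pi> (\<lambda>\<theta>. ennreal (w \<omega> \<theta>)))"
      using prediction_mean(2)[OF mean[OF \<omega>] x'] by (simp add: gibbs_posterior_def w_def r_def)
    also have "\<dots> = (\<integral>\<theta>. w \<omega> \<theta> *\<^sub>R f \<theta> (x \<omega>') \<partial>\<pi>)"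
      by (rule integral_density[OF f]) (measurable, simp add: w_def)
    finally show "loss (prediction X k f (\<theta>hat \<omega>) t \<omega>') (X t \<omega>') = F \<omega> \<omega>'"
      by (simp add: loss_eq F_def prediction_def x_def)
  qed
  ultimately show ?thesis
    by (subst measurable_cong) auto
qed

section \<open>The good event and the oracle inequality\<close>

lemma exp_moment_bad_event:
  assumes n: "k < n" and \<epsilon>: "0 < \<epsilon>"
  defines "\<kappa> \<equiv> K * (1 + L) * (B + C) / sqrt 2"
  shows "prob {\<omega> \<in> space M. ennreal (2 / \<epsilon>) \<le> (\<integral>\<^sup>+\<theta>. ennreal (exp (s * (risk M X k f loss t \<theta>
      - empirical_risk X n k f loss \<theta> \<omega>) - s\<^sup>2 * \<kappa>\<^sup>2 / (real n * (1 - real k / real n)\<^sup>2))) \<partial>\<pi>)} \<le> \<epsilon> / 2"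
proof (rule prob_nn_integral_ge[OF prior _ _ \<epsilon>])
  have [measurable]: "(\<lambda>p. empirical_risk X n k f loss (fst p) (snd p)) \<in> borel_measurable (\<pi> \<Otimes>\<^sub>M M)"
    using empirical_risk_measurable by (simp add: case_prod_beta)
  show "(\<lambda>(\<theta>, \<omega>). ennreal (exp (s * (risk M X k f loss t \<theta>
      - empirical_risk X n k f loss \<theta> \<omega>) - s\<^sup>2 * \<kappa>\<^sup>2 / (real n * (1 - real k / real n)\<^sup>2))))
      \<in> borel_measurable (\<pi> \<Otimes>\<^sub>M M)"
    unfolding case_prod_beta by measurable
qed (use exp_moment[OF _ n] in \<open>simp add: \<kappa>_def\<close>)

text \<open>The upper bound on the posterior risk and the lower bound on \<open>ln Z\<close> are
  added, so that \<open>ln Z\<close> disappears. Each contributes one \<open>lam * V\<close> and one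
  \<open>ln (2 / \<epsilon>)\<close>, and dividing by \<open>lam\<close> gives the claim.\<close>

lemma oracle_inequality_on_good_event:
  assumes n: "k < n" and lam: "0 < lam" and \<epsilon>: "0 < \<epsilon>" and \<omega>: "\<omega> \<in> space M"
    and mean: "is_mean (gibbs_posterior \<pi> (\<lambda>\<theta>. empirical_risk X n k f loss \<theta> \<omega>) lam) m"
    and upper: "(\<integral>\<^sup>+\<theta>. ennreal (exp (lam * (risk M X k f loss t \<theta>
      - empirical_risk X n k f loss \<theta> \<omega>) - lam * V)) \<partial>\<pi>) \<le> ennreal (2 / \<epsilon>)"
    and lower: "(\<integral>\<^sup>+\<theta>. ennreal (exp (lam * (empirical_risk X n k f loss \<theta> \<omega>
      - risk M X k f loss t \<theta>) - lam * V)) \<partial>\<pi>) \<le> ennreal (2 / \<epsilon>)"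
    and \<rho>: "\<rho> \<in> space (prob_algebra \<pi>)"
  shows "ereal (risk M X k f loss t m) \<le>
    enn2ereal (\<integral>\<^sup>+ \<theta>. ennreal (risk M X k f loss t \<theta>) \<partial>\<rho>) + ereal (2 * V)
      + (2 * kl \<rho> \<pi> + ereal (2 * ln (2 / \<epsilon>))) / ereal lam"
proof -
  let ?R = "risk M X k f loss t"
  interpret G: gibbs \<pi> "\<lambda>\<theta>. empirical_risk X n k f loss \<theta> \<omega>" ?R lam
    by (rule gibbs_empirical[OF n lam \<omega>])
  have \<epsilon>2: "0 < 2 / \<epsilon>" using \<epsilon> by simp
  have "?R m \<le> (\<integral>\<theta>. ?R \<theta> \<partial>G.post)"
    by (rule risk_mean_le[OF G.prob_space_post G.sets_post mean G.posterior_risk_bound(1)[OF upper \<epsilon>2]])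
  then have "lam * ?R m \<le> lam * (\<integral>\<theta>. ?R \<theta> \<partial>G.post)"
    using lam by simp
  also have "\<dots> \<le> lam * V + ln (2 / \<epsilon>) - ln G.Z"
    by (rule G.posterior_risk_bound(2)[OF upper \<epsilon>2])
  finally have post: "lam * ?R m \<le> lam * V + ln (2 / \<epsilon>) - ln G.Z" .
  have \<rho>': "prob_space \<rho>" "sets \<rho> = sets \<pi>"
    using \<rho> by (auto simp: space_prob_algebra)
  have R\<rho>: "?R \<in> borel_measurable \<rho>"
    using risk_measurable by (simp add: measurable_cong_sets[OF \<rho>'(2) refl])
  show ?thesis
  proof (cases "absolutely_continuous \<pi> \<rho> \<and> integrable \<rho> (entropy_density (exp 1) \<pi> \<rho>)
      \<and> (\<integral>\<^sup>+ \<theta>. ennreal (?R \<theta>) \<partial>\<rho>) < \<infinity>")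
    case True
    then have int: "integrable \<rho> ?R"
      by (intro integrableI_nonneg R\<rho>) (auto simp: risk_nonneg)
    have "- ln G.Z \<le> lam * (\<integral>\<theta>. ?R \<theta> \<partial>\<rho>) + 2 * KL_divergence (exp 1) \<pi> \<rho> + lam * V + ln (2 / \<epsilon>)"
      by (rule G.free_energy_bound[OF lower \<epsilon>2 \<rho>' _ _ int]) (use True in auto)
    with post have "lam * ?R m \<le> lam * (\<integral>\<theta>. ?R \<theta> \<partial>\<rho>) + 2 * (lam * V)
        + (2 * KL_divergence (exp 1) \<pi> \<rho> + 2 * ln (2 / \<epsilon>))"
      by simp
    then have "?R m \<le> (\<integral>\<theta>. ?R \<theta> \<partial>\<rho>) + 2 * V + (2 * KL_divergence (exp 1) \<pi> \<rho> + 2 * ln (2 / \<epsilon>)) / lam"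
      using lam by (simp add: field_simps)
    moreover have "(\<integral>\<^sup>+ \<theta>. ennreal (?R \<theta>) \<partial>\<rho>) = ennreal (\<integral>\<theta>. ?R \<theta> \<partial>\<rho>)"
      by (intro nn_integral_eq_integral int) (simp add: risk_nonneg)
    moreover have "kl \<rho> \<pi> = ereal (KL_divergence (exp 1) \<pi> \<rho>)"
      using True by (simp add: kl_def)
    ultimately show ?thesis
      using lam by (simp add: risk_nonneg)
  next
    \<comment> \<open>If the divergence or the risk integral is infinite, so is the right-hand
      side.\<close>
    case False
    have "enn2ereal (\<integral>\<^sup>+ \<theta>. ennreal (?R \<theta>) \<partial>\<rho>) + ereal (2 * V)
        + (2 * kl \<rho> \<pi> + ereal (2 * ln (2 / \<epsilon>))) / ereal lam = \<infinity>"
    proof (cases "absolutely_continuous \<pi> \<rho> \<and> integrable \<rho> (entropy_density (exp 1) \<pi> \<rho>)")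
      case True
      with False have "(\<integral>\<^sup>+ \<theta>. ennreal (?R \<theta>) \<partial>\<rho>) = \<infinity>" by (simp add: less_top[symmetric])
      with True lam show ?thesis by (simp add: kl_def)
    next
      case False
      then have "kl \<rho> \<pi> = \<infinity>" by (simp add: kl_def)
      moreover have "enn2ereal (\<integral>\<^sup>+ \<theta>. ennreal (?R \<theta>) \<partial>\<rho>) \<noteq> -\<infinity>"
        using enn2ereal_nonneg[of "\<integral>\<^sup>+ \<theta>. ennreal (?R \<theta>) \<partial>\<rho>"] by auto
      ultimately show ?thesis using lam by simp
    qed
    then show ?thesis by (simp only: ereal_less_eq(1))
  qed
qed

text \<open>Failure of the inequality forces one of two bad events of probability at most
  \<open>\<epsilon> / 2\<close>. These do not involve \<open>\<rho>\<close>, so a single good event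
  serves the whole infimum.\<close>

lemma oracle_inequality:
  assumes n: "k < n" and lam: "0 < lam" and \<epsilon>: "0 < \<epsilon>"
    and mean: "\<And>\<omega>. \<omega> \<in> space M \<Longrightarrow>
      is_mean (gibbs_posterior \<pi> (\<lambda>\<theta>. empirical_risk X n k f loss \<theta> \<omega>) lam) (\<theta>hat \<omega>)"
  defines "\<kappa> \<equiv> K * (1 + L) * (B + C) / sqrt 2"
  shows "prob {\<omega> \<in> space M. ereal (risk M X k f loss t (\<theta>hat \<omega>)) \<le>
      (INF \<rho> \<in> space (prob_algebra \<pi>).
         enn2ereal (\<integral>\<^sup>+ \<theta>. ennreal (risk M X k f loss t \<theta>) \<partial>\<rho>)
         + ereal (2 * lam * \<kappa>\<^sup>2 / (real n * (1 - real k / real n)\<^sup>2))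
         + (2 * kl \<rho> \<pi> + ereal (2 * ln (2 / \<epsilon>))) / ereal lam)} \<ge> 1 - \<epsilon>"
    (is "prob {\<omega> \<in> space M. ?good \<omega>} \<ge> _")
proof -
  define V where "V = lam * \<kappa>\<^sup>2 / (real n * (1 - real k / real n)\<^sup>2)"
  have V: "lam\<^sup>2 * \<kappa>\<^sup>2 / (real n * (1 - real k / real n)\<^sup>2) = lam * V"
    "(- lam)\<^sup>2 * \<kappa>\<^sup>2 / (real n * (1 - real k / real n)\<^sup>2) = lam * V"
    "2 * lam * \<kappa>\<^sup>2 / (real n * (1 - real k / real n)\<^sup>2) = 2 * V"
    by (simp_all add: V_def power2_eq_square)
  let ?bad = "\<lambda>s. {\<omega> \<in> space M. ennreal (2 / \<epsilon>) \<le> (\<integral>\<^sup>+\<theta>. ennreal (exp (s * (risk M X k f loss t \<theta>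
      - empirical_risk X n k f loss \<theta> \<omega>) - lam * V)) \<partial>\<pi>)}"
  have [measurable]: "(\<lambda>\<omega>. risk M X k f loss t (\<theta>hat \<omega>)) \<in> borel_measurable M"
    by (rule risk_estimator_measurable[OF mean])
  \<comment> \<open>The infimum is constant in \<open>\<omega>\<close>, so measurability of the risk
    at the estimator suffices.\<close>
  have good_sets: "{\<omega> \<in> space M. ?good \<omega>} \<in> sets M" by measurable
  have [measurable]: "(\<lambda>(\<omega>, \<theta>). empirical_risk X n k f loss \<theta> \<omega>) \<in> borel_measurable (M \<Otimes>\<^sub>M \<pi>)"
    using measurable_compose[OF measurable_pair_swap' empirical_risk_measurable[of n]]
    by (simp add: case_prod_beta)
  have bad_sets: "?bad s \<in> sets M" for s by measurable
  have bad: "prob (?bad lam) \<le> \<epsilon> / 2" "prob (?bad (- lam)) \<le> \<epsilon> / 2"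
    using exp_moment_bad_event[OF n \<epsilon>, of lam t] exp_moment_bad_event[OF n \<epsilon>, of "- lam" t]
    unfolding \<kappa>_def[symmetric] V by blast+
  have "space M - {\<omega> \<in> space M. ?good \<omega>} \<subseteq> ?bad lam \<union> ?bad (- lam)"
  proof (rule subsetI, rule ccontr)
    fix \<omega> assume *: "\<omega> \<in> space M - {\<omega> \<in> space M. ?good \<omega>}" "\<omega> \<notin> ?bad lam \<union> ?bad (- lam)"
    have "(- lam) * (risk M X k f loss t \<theta> - empirical_risk X n k f loss \<theta> \<omega>)
        = lam * (empirical_risk X n k f loss \<theta> \<omega> - risk M X k f loss t \<theta>)" for \<theta>
      by (simp add: algebra_simps)
    with * have "?good \<omega>"
      unfolding V
      by (intro INF_greatest oracle_inequality_on_good_event[OF n lam \<epsilon> _ mean]) (auto simp: not_le less_imp_le)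
    with * show False by simp
  qed
  then have "prob (space M - {\<omega> \<in> space M. ?good \<omega>}) \<le> prob (?bad lam \<union> ?bad (- lam))"
    by (intro finite_measure_mono sets.Un bad_sets)
  also have "\<dots> \<le> prob (?bad lam) + prob (?bad (- lam))"
    by (intro measure_Un_le bad_sets)
  also have "\<dots> \<le> \<epsilon>" using bad by linarith
  finally show ?thesis
    using prob_compl[OF good_sets] by simp
qed

end

text \<open>The estimator is any choice, outcome by outcome, of a weak mean of the Gibbs posterior.
  Extended reals let those \<open>\<rho>\<close> with infinite risk or divergence stay in the
  infimum.\<close>

theorem theorem9:
  fixes M :: "'w measure"
    and X :: "int \<Rightarrow> 'w \<Rightarrow> real ^ 'p"
    and k n :: nat
    and \<Theta> :: "'b::{real_vector, topological_space} set"
    and \<pi> :: "'b measure"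
    and f :: "'b \<Rightarrow> (nat \<Rightarrow> real ^ 'p) \<Rightarrow> real ^ 'p"
    and loss :: "real ^ 'p \<Rightarrow> real ^ 'p \<Rightarrow> real"
    and B K L C \<kappa> lam \<epsilon> :: real
    and t :: int
    and \<theta>hat :: "'w \<Rightarrow> 'b"
  assumes "prob_space M" and "stationary M X"
    and "1 \<le> k" and "k < n"
    and "prob_space \<pi>" and "space \<pi> = \<Theta>"
    and linear: "\<And>x. x \<in> tuples k \<Longrightarrow> linear (\<lambda>\<theta>. f \<theta> x) \<and> continuous_on UNIV (\<lambda>\<theta>. f \<theta> x)"
    and measurable: "(\<lambda>(\<theta>, x). f \<theta> x) \<in> borel_measurable (\<pi> \<Otimes>\<^sub>M Pi\<^sub>M {1..k} (\<lambda>_. borel))"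
    and "0 < B" and "0 < K" and "0 < L" and "0 < C"
    and Bound: "AE \<omega> in M. norm (X 0 \<omega>) \<le> B"
    and "LipLoss K loss" and "Lip L k \<Theta> f" and "WeakDep C M X"
    and "\<kappa> = K * (1 + L) * (B + C) / sqrt 2"
    and "0 < lam" and "0 < \<epsilon>"
    and Gibbs: "\<And>\<omega>. \<omega> \<in> space M \<Longrightarrow>
      is_mean (gibbs_posterior \<pi> (\<lambda>\<theta>. empirical_risk X n k f loss \<theta> \<omega>) lam) (\<theta>hat \<omega>)"
  shows "measure M {\<omega> \<in> space M. ereal (risk M X k f loss t (\<theta>hat \<omega>)) \<le>
      (INF \<rho> \<in> space (prob_algebra \<pi>).
         enn2ereal (\<integral>\<^sup>+ \<theta>. ennreal (risk M X k f loss t \<theta>) \<partial>\<rho>)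
         + ereal (2 * lam * \<kappa>\<^sup>2 / (real n * (1 - real k / real n)\<^sup>2))
         + (2 * kl \<rho> \<pi> + ereal (2 * ln (2 / \<epsilon>))) / ereal lam)} \<ge> 1 - \<epsilon>"
proof -
  obtain g where g: "\<And>x x'. loss x x' = g (x - x')" "convex_on UNIV g" "K-lipschitz_on UNIV g"
    "\<And>x. 0 \<le> g x" "g 0 = 0"
    using \<open>LipLoss K loss\<close> unfolding LipLoss_def by auto
  interpret prob_space M by fact
  interpret \<pi>: prob_space \<pi> by fact
  interpret forecasting M X B C \<pi> k f loss g K L
  proof unfold_locales
    show "Lip L k (space \<pi>) f" using \<open>Lip L k \<Theta> f\<close> \<open>space \<pi> = \<Theta>\<close> by simp
  qed (fact assms g)+
  show ?thesis
    unfolding \<open>\<kappa> = _\<close>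
    by (rule oracle_inequality[OF \<open>k < n\<close> \<open>0 < lam\<close> \<open>0 < \<epsilon>\<close> Gibbs])
qed

end
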